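(* There exist a randomized online paging algorithm and an absolute constant $c>0$ such that, for every paging instance (pages $[n]$, cache size $k<n$, request sequence $\sigma\in[n]^T$) and every collection of $M$ NAT predictors, when the algorithm has full information access to the $M$ predictors its expected cost satisfies $$\mathbb{E}[\operatorname{cost}(\mathtt{Alg})]-\mathtt{OPT}\le c\left(\eta^{\min}+k+\sqrt{Tk\log M}\right),$$ where $\eta^{\min}=\min_{j\in[M]}\eta^j$ and $\eta^j=|\{t\in[T]:p^j_t\neq A_t(\sigma_t)\}|$.
   Context: Paging: $n$ pages, cache of exactly $k<n$ pages, request sequence $\sigma=(\sigma_t)_{t\in[T]}\in[n]^T$ revealed online; a cache miss at round $t$ occurs when $\sigma_t$ is not in the cache, and then some cached page must be evicted to bring in $\sigma_t$; the cost is the number of cache misses. With virtual requests $\sigma_{T+i}=i$ ($i\in[n]$), the next arrival time is $A_t(i)=\min\{t'>t:\sigma_{t'}=i\}$. $\mathtt{OPT}$ is the cost of the optimal offline algorithm (furthest in the future, evicting the cached page maximizing $A_t(i)$). A NAT predictor $j\in[M]$ produces in each round $t$ a prediction $p^j_t\in(t,T+n]$ for $A_t(\sigma_t)$. Full information access: in each round $t$ the algorithm receives $p^j_t$ for all $j\in[M]$; if the algorithm must evict in round $t$, the eviction decision is made before receiving the round-$t$ predictions. The algorithm does not know which predictor is best nor the values $\eta^j$. *)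

theory Defs
  imports "HOL-Probability.Probability"
begin

type_synonym page = nat

text \<open>
  Rounds are \<open>1, \<dots>, T\<close> and pages are \<open>1, \<dots>, n\<close>; a request sequence is a function of the round,
  of which only the values on \<open>{1..T}\<close> are meaningful. A cache schedule \<open>C\<close> gives the cache
  content \<open>C t\<close> at the end of round \<open>t\<close>, with \<open>C 0\<close> the initial content.
\<close>

definition paging_instance :: "nat \<Rightarrow> nat \<Rightarrow> nat \<Rightarrow> page set \<Rightarrow> (nat \<Rightarrow> page) \<Rightarrow> bool" where
  "paging_instance n k T C0 \<sigma> \<longleftrightarrow>
     1 \<le> k \<and> k < n \<and> C0 \<subseteq> {1..n} \<and> card C0 = k \<and> (\<forall>t\<in>{1..T}. \<sigma> t \<in> {1..n})"

definition serve :: "page set \<Rightarrow> page \<Rightarrow> page \<Rightarrow> page set" where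
  "serve C x e = (if x \<in> C then C else insert x (C - {e}))"

definition misses :: "nat \<Rightarrow> (nat \<Rightarrow> page) \<Rightarrow> (nat \<Rightarrow> page set) \<Rightarrow> nat" where
  "misses T \<sigma> C = card {t \<in> {1..T}. \<sigma> t \<notin> C (t - 1)}"

definition feasible_schedule :: "nat \<Rightarrow> page set \<Rightarrow> (nat \<Rightarrow> page) \<Rightarrow> (nat \<Rightarrow> page set) \<Rightarrow> bool" where
  "feasible_schedule T C0 \<sigma> C \<longleftrightarrow>
     C 0 = C0 \<and> (\<forall>t\<in>{1..T}. \<exists>e\<in>C (t - 1). C t = serve (C (t - 1)) (\<sigma> t) e)"

definition OPT :: "nat \<Rightarrow> page set \<Rightarrow> (nat \<Rightarrow> page) \<Rightarrow> nat" where
  "OPT T C0 \<sigma> = (INF C \<in> {C. feasible_schedule T C0 \<sigma> C}. misses T \<sigma> C)"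

text \<open>The virtual requests after round \<open>T\<close> are \<open>\<sigma> (T + i) = i\<close> for \<open>i \<in> {1..n}\<close>.\<close>

definition next_arrival :: "nat \<Rightarrow> (nat \<Rightarrow> page) \<Rightarrow> nat \<Rightarrow> page \<Rightarrow> nat" where
  "next_arrival T \<sigma> t i = (LEAST t'. t < t' \<and> (if t' \<le> T then \<sigma> t' else t' - T) = i)"

text \<open>\<open>p j t\<close> is the prediction of predictor \<open>j\<close> in round \<open>t\<close> for \<open>next_arrival T \<sigma> t (\<sigma> t)\<close>.\<close>

definition nat_predictors :: "nat \<Rightarrow> nat \<Rightarrow> nat \<Rightarrow> (nat \<Rightarrow> nat \<Rightarrow> nat) \<Rightarrow> bool" where
  "nat_predictors n T M p \<longleftrightarrow> (\<forall>j\<in>{1..M}. \<forall>t\<in>{1..T}. p j t \<in> {t<..T + n})"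

definition pred_errors :: "nat \<Rightarrow> (nat \<Rightarrow> page) \<Rightarrow> (nat \<Rightarrow> nat) \<Rightarrow> nat" where
  "pred_errors T \<sigma> q = card {t \<in> {1..T}. q t \<noteq> next_arrival T \<sigma> t (\<sigma> t)}"

definition min_pred_errors :: "nat \<Rightarrow> (nat \<Rightarrow> page) \<Rightarrow> nat \<Rightarrow> (nat \<Rightarrow> nat \<Rightarrow> nat) \<Rightarrow> nat" where
  "min_pred_errors T \<sigma> M p = Min ((\<lambda>j. pred_errors T \<sigma> (p j)) ` {1..M})"

text \<open>
  What an online algorithm knows when it acts in round \<open>t\<close>: the parameters \<open>n\<close>, \<open>k\<close>, \<open>M\<close> (but not
  the horizon \<open>T\<close>), the requests of rounds \<open>1, \<dots>, t\<close>, the predictions of all \<open>M\<close> predictors in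
  rounds \<open>1, \<dots>, t - 1\<close>, its own caches at the end of rounds \<open>0, \<dots>, t - 1\<close>, and the outcomes of
  its private random draws in rounds \<open>1, \<dots>, t - 1\<close>.
\<close>

record view =
  num_pages :: nat
  cache_size :: nat
  num_predictors :: nat
  requests :: "page list"
  predictions :: "nat list list"
  caches :: "page set list"
  draws :: "nat list"

text \<open>
  In every round a randomized algorithm randomly chooses a page to evict, which takes effect only
  if there is a cache miss, together with a natural number that it remembers. The latter makes
  correlated random choices across rounds possible, that is, any private random memory.
\<close>

type_synonym rand_alg = "view \<Rightarrow> (page \<times> nat) pmf"

definition rand_paging_alg :: "rand_alg \<Rightarrow> bool" where
  "rand_paging_alg A \<longleftrightarrow>
     (\<forall>v. last (requests v) \<notin> last (caches v) \<and> last (caches v) \<noteq> {} \<longrightarrow>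
        (\<forall>(e, r)\<in>set_pmf (A v). e \<in> last (caches v)))"

definition view_at ::
  "nat \<Rightarrow> nat \<Rightarrow> nat \<Rightarrow> (nat \<Rightarrow> page) \<Rightarrow> (nat \<Rightarrow> nat \<Rightarrow> nat) \<Rightarrow> nat \<Rightarrow> page set list \<Rightarrow> nat list \<Rightarrow> view"
where
  "view_at n k M \<sigma> p t Cs rs =
     \<lparr> num_pages = n, cache_size = k, num_predictors = M,
       requests = map \<sigma> [1..<t + 1],
       predictions = map (\<lambda>s. map (\<lambda>j. p j s) [1..<M + 1]) [1..<t],
       caches = Cs, draws = rs \<rparr>"

text \<open>Joint distribution of the caches and of the private draws after the given number of rounds.\<close>

primrec run ::
  "rand_alg \<Rightarrow> nat \<Rightarrow> nat \<Rightarrow> nat \<Rightarrow> page set \<Rightarrow> (nat \<Rightarrow> page) \<Rightarrow> (nat \<Rightarrow> nat \<Rightarrow> nat) \<Rightarrow> nat \<Rightarrow>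
     (page set list \<times> nat list) pmf"
where
  "run A n k M C0 \<sigma> p 0 = return_pmf ([C0], [])"
| "run A n k M C0 \<sigma> p (Suc t) =
     do {
       (Cs, rs) \<leftarrow> run A n k M C0 \<sigma> p t;
       (e, r) \<leftarrow> A (view_at n k M \<sigma> p (Suc t) Cs rs);
       return_pmf (Cs @ [serve (last Cs) (\<sigma> (Suc t)) e], rs @ [r])
     }"

definition expected_cost ::
  "rand_alg \<Rightarrow> nat \<Rightarrow> nat \<Rightarrow> nat \<Rightarrow> nat \<Rightarrow> page set \<Rightarrow> (nat \<Rightarrow> page) \<Rightarrow> (nat \<Rightarrow> nat \<Rightarrow> nat) \<Rightarrow> real"
where
  "expected_cost A n k M T C0 \<sigma> p =
     measure_pmf.expectation (run A n k M C0 \<sigma> p T) (\<lambda>(Cs, rs). real (misses T \<sigma> ((!) Cs)))"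

end

theory Submission
  imports Defs
begin

text \<open>
  A prediction \<open>q u\<close> made in round \<open>u\<close> is read as an interval \<open>(u, q u)\<close>. A page hit amounts to
  holding such an interval for its whole length, so offline paging is the problem of choosing as
  many intervals as possible with at most \<open>k - 1\<close> of them over any round. Every predictor yields an
  expert that runs furthest-in-the-future greedily on its own predicted intervals; greedy is optimal
  for these, and each wrong prediction changes one interval, so the expert misses at most
  \<open>OPT + k + 2 \<eta>\<close> times.

  The algorithm lazily imitates the cache of one expert at a time, which costs the misses of the
  imitated experts plus \<open>k\<close> per switch. The expert of round \<open>t + 1\<close> is distributed according to Hedge
  on the first \<open>t\<close> rounds with learning rate \<open>sqrt (ln M / (k (t + 1)))\<close>, correlated over time as in
  the shrinking dartboard algorithm so that the probability of a switch is of the order of the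
  learning rate.
\<close>

section \<open>Greedy scheduling of intervals\<close>

definition running :: "(nat \<Rightarrow> nat) \<Rightarrow> nat set \<Rightarrow> nat \<Rightarrow> nat set" where
  "running q U t = {u \<in> U. u < t \<and> t < q u}"

definition completed :: "(nat \<Rightarrow> nat) \<Rightarrow> nat set \<Rightarrow> nat \<Rightarrow> nat set" where
  "completed q U s = {u \<in> U. q u \<le> s}"

definition drop_furthest :: "nat \<Rightarrow> (nat \<Rightarrow> nat) \<Rightarrow> nat \<Rightarrow> nat set \<Rightarrow> nat set" where
  "drop_furthest k q t U =
     (if card (running q U t) < k then U else U - {arg_max_on q (running q U t)})"

text \<open>Completed intervals stay in the greedy set; only dropped ones leave it.\<close>

primrec greedy :: "nat \<Rightarrow> (nat \<Rightarrow> nat) \<Rightarrow> nat \<Rightarrow> nat set" where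
  "greedy k q 0 = {}"
| "greedy k q (Suc t) = insert (Suc t) (drop_furthest k q (Suc t) (greedy k q t))"

lemma arg_max_on_in_ge:
  fixes f :: "'a \<Rightarrow> 'b :: linorder"
  assumes "finite S" "S \<noteq> {}"
  shows "arg_max_on f S \<in> S" "\<And>y. y \<in> S \<Longrightarrow> f y \<le> f (arg_max_on f S)"
proof -
  have "Max (f ` S) \<in> f ` S"
    using assms by simp
  then obtain x where "x \<in> S" "f x = Max (f ` S)"
    by auto
  then have "is_arg_max f (\<lambda>x. x \<in> S) x"
    using assms(1) by (simp add: is_arg_max_linorder)
  then have "is_arg_max f (\<lambda>x. x \<in> S) (arg_max_on f S)"
    unfolding arg_max_on_def arg_max_def by (rule someI)
  then show "arg_max_on f S \<in> S" "\<And>y. y \<in> S \<Longrightarrow> f y \<le> f (arg_max_on f S)"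
    by (simp_all add: is_arg_max_linorder)
qed

lemma arg_max_on_cong:
  assumes "\<And>x. x \<in> S \<Longrightarrow> f x = g x"
  shows "arg_max_on f S = arg_max_on g S"
  unfolding arg_max_on_def arg_max_def is_arg_max_def
  by (rule arg_cong[where f = Eps]) (auto simp: assms)

lemma finite_running: "finite U \<Longrightarrow> finite (running q U t)"
  by (simp add: running_def)

lemma finite_completed: "finite U \<Longrightarrow> finite (completed q U s)"
  by (simp add: completed_def)

lemma completed_insert:
  "completed q (insert u U) s = (if q u \<le> s then insert u (completed q U s) else completed q U s)"
  by (auto simp: completed_def)

lemma card_completed_insert_le:
  assumes "finite U"
  shows "card (completed q (insert u U) s) \<le> card (completed q U s) + of_bool (q u \<le> s)"
  using assms by (simp add: completed_insert card_insert_if finite_completed)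

lemma card_completed_le_completed_running:
  assumes "finite U" "U \<subseteq> {..<t}"
  shows "card (completed q U s) \<le> card (completed q U t) + card (running q U t)"
proof -
  have "completed q U s \<subseteq> completed q U t \<union> running q U t"
    using assms(2) by (auto simp: completed_def running_def)
  then have "card (completed q U s) \<le> card (completed q U t \<union> running q U t)"
    using assms(1) by (intro card_mono) (simp_all add: finite_running finite_completed)
  then show ?thesis
    using card_Un_le le_trans by blast
qed

lemma drop_furthest_subset: "drop_furthest k q t U \<subseteq> U"
  by (auto simp: drop_furthest_def)

lemma card_running_drop_furthest:
  assumes "finite U" "1 \<le> k" "card (running q U t) \<le> k"
  shows "card (running q (drop_furthest k q t U) t) < k"
proof (cases "card (running q U t) < k")
  case False
  define x where "x = arg_max_on q (running q U t)"
  have "x \<in> running q U t"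
    unfolding x_def using False assms(1,2) by (intro arg_max_on_in_ge finite_running) auto
  moreover have "running q (drop_furthest k q t U) t = running q U t - {x}"
    using False by (auto simp: drop_furthest_def x_def running_def)
  ultimately show ?thesis
    using assms by (simp add: finite_running card_gt_0_iff)
qed (simp add: drop_furthest_def)

text \<open>
  If the dropped interval is completed by time \<open>s\<close>, so are all other running ones, since it ends
  last among them.
\<close>

lemma card_completed_drop_furthest:
  assumes "finite U" "t \<le> s" "1 \<le> k"
  shows "min (card (completed q U s)) (card (completed q U t) + (k - 1))
    \<le> card (completed q (drop_furthest k q t U) s)"
proof (cases "card (running q U t) < k")
  case False
  define R x where "R = running q U t" and "x = arg_max_on q R"
  have R: "finite R" "R \<noteq> {}" "k \<le> card R"
    using False assms by (auto simp: R_def finite_running)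
  note x = arg_max_on_in_ge[OF R(1,2), where f = q, folded x_def]
  have drop: "drop_furthest k q t U = U - {x}"
    using False by (simp add: drop_furthest_def R_def x_def)
  show ?thesis
  proof (cases "q x \<le> s")
    case True
    have "card (completed q U t) + (k - 1) \<le> card (completed q U t) + card (R - {x})"
      using R x(1) by simp
    also have "\<dots> = card (completed q U t \<union> (R - {x}))"
      using R(1) assms(1)
      by (intro card_Un_disjoint[symmetric])
        (auto simp: finite_completed completed_def R_def running_def)
    also have "\<dots> \<le> card (completed q (U - {x}) s)"
    proof (intro card_mono finite_completed)
      show "completed q U t \<union> (R - {x}) \<subseteq> completed q (U - {x}) s"
        using x True assms(2) by (fastforce simp: completed_def R_def running_def)
    qed (simp add: assms(1))
    finally show ?thesis
      unfolding drop by simp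
  next
    case False
    then have "completed q (U - {x}) s = completed q U s"
      by (auto simp: completed_def)
    then show ?thesis
      unfolding drop by simp
  qed
qed (simp add: drop_furthest_def)

lemma greedy_subset: "greedy k q t \<subseteq> {1..t}"
proof (induction t)
  case (Suc t)
  then show ?case
    using drop_furthest_subset[of k q "Suc t" "greedy k q t"] by force
qed simp

lemma finite_greedy: "finite (greedy k q t)"
  by (rule finite_subset[OF greedy_subset]) simp

lemma greedy_Suc_subset: "greedy k q (Suc t) \<subseteq> insert (Suc t) (greedy k q t)"
  using drop_furthest_subset by (simp add: subset_insertI2)

lemma greedy_antimono:
  assumes "u \<in> greedy k q t" "u \<le> s" "s \<le> t"
  shows "u \<in> greedy k q s"
  using assms(3,1,2)
proof (induction t rule: dec_induct)
  case (step t)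
  then show ?case
    using greedy_Suc_subset[of k q t] by auto
qed simp

lemma card_running_greedy:
  assumes "1 \<le> k"
  shows "card (running q (greedy k q t) t) < k"
proof (induction t)
  case 0
  then show ?case
    using assms by (simp add: running_def)
next
  case (Suc t)
  let ?U = "greedy k q t"
  have "running q ?U (Suc t) \<subseteq> insert t (running q ?U t)"
    by (auto simp: running_def)
  then have "card (running q ?U (Suc t)) \<le> card (insert t (running q ?U t))"
    by (intro card_mono) (simp_all add: finite_running finite_greedy)
  also have "\<dots> \<le> k"
    using Suc by (simp add: card_insert_if finite_running finite_greedy)
  finally have "card (running q (drop_furthest k q (Suc t) ?U) (Suc t)) < k"
    by (intro card_running_drop_furthest finite_greedy assms)
  moreover have "running q (greedy k q (Suc t)) (Suc t)
      = running q (drop_furthest k q (Suc t) ?U) (Suc t)"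
    by (auto simp: running_def)
  ultimately show ?case
    by simp
qed

lemma greedy_cong:
  assumes "\<And>u. u \<in> {1..<t} \<Longrightarrow> q u = q' u"
  shows "greedy k q t = greedy k q' t"
  using assms
proof (induction t)
  case (Suc t)
  let ?R = "running q (greedy k q t) (Suc t)"
  have eq: "q u = q' u" if "u \<in> greedy k q t" for u
    using that greedy_subset[of k q t] Suc.prems by force
  then have "running q' (greedy k q t) (Suc t) = ?R"
    by (auto simp: running_def)
  moreover have "arg_max_on q' ?R = arg_max_on q ?R"
    by (rule arg_max_on_cong) (use eq in \<open>auto simp: running_def\<close>)
  ultimately show ?case
    using Suc by (simp add: drop_furthest_def)
qed simp

lemma card_completed_greedy_Suc:
  "card (completed q (greedy k q (Suc t)) s)
    = card (completed q (drop_furthest k q (Suc t) (greedy k q t)) s) + of_bool (q (Suc t) \<le> s)"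
proof -
  let ?D = "drop_furthest k q (Suc t) (greedy k q t)"
  have "finite ?D" "Suc t \<notin> ?D"
    using drop_furthest_subset[of k q "Suc t" "greedy k q t"] greedy_subset[of k q t]
    by (auto intro: finite_subset[OF _ finite_greedy])
  then have "finite (completed q ?D s)" "Suc t \<notin> completed q ?D s"
    by (simp_all add: completed_def)
  then show ?thesis
    by (simp add: completed_insert)
qed

theorem greedy_stays_ahead:
  assumes X: "finite X" "0 \<notin> X"
    and capacity: "\<And>t. t \<in> {1..T} \<Longrightarrow> card (running q X t) < k"
    and "t \<le> T" "t \<le> s"
  shows "card (completed q (X \<inter> {..t}) s) \<le> card (completed q (greedy k q t) s)"
  using assms(4,5)
proof (induction t arbitrary: s)
  case 0
  then show ?case
    using X by (simp add: completed_def Int_absorb2)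
next
  case (Suc t)
  let ?Y = "X \<inter> {..t}" and ?U = "greedy k q t"
  let ?D = "drop_furthest k q (Suc t) ?U"
  have IH: "card (completed q ?Y s') \<le> card (completed q ?U s')" if "t \<le> s'" for s'
    using Suc that by simp
  have "card (running q ?Y (Suc t)) \<le> card (running q X (Suc t))"
    using X by (intro card_mono finite_running) (auto simp: running_def)
  then have "card (running q ?Y (Suc t)) \<le> k - 1" and k: "1 \<le> k"
    using capacity[of "Suc t"] Suc.prems by auto
  then have "card (completed q ?Y s) \<le> card (completed q ?U (Suc t)) + (k - 1)"
    using card_completed_le_completed_running[of ?Y "Suc t" q s] X IH[of "Suc t"] by force
  moreover have "card (completed q ?Y s) \<le> card (completed q ?U s)"
    using IH[of s] Suc.prems by simp
  ultimately have drop: "card (completed q ?Y s) \<le> card (completed q ?D s)"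
    using card_completed_drop_furthest[OF finite_greedy Suc.prems(2) k, of q k q t] by linarith
  have "completed q (X \<inter> {..Suc t}) s \<subseteq> completed q (insert (Suc t) ?Y) s"
    by (auto simp: completed_def le_Suc_eq)
  then have "card (completed q (X \<inter> {..Suc t}) s) \<le> card (completed q (insert (Suc t) ?Y) s)"
    using X by (intro card_mono finite_completed) auto
  also have "\<dots> \<le> card (completed q ?Y s) + of_bool (q (Suc t) \<le> s)"
    using X by (intro card_completed_insert_le) simp
  also have "\<dots> \<le> card (completed q (greedy k q (Suc t)) s)"
    using drop by (simp only: card_completed_greedy_Suc add_le_cancel_right)
  finally show ?case .
qed

section \<open>Cache schedules as sets of intervals\<close>

definition next_request :: "nat \<Rightarrow> (nat \<Rightarrow> page) \<Rightarrow> nat \<Rightarrow> nat" where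
  "next_request T \<sigma> u = next_arrival T \<sigma> u (\<sigma> u)"

definition hits :: "nat \<Rightarrow> (nat \<Rightarrow> page) \<Rightarrow> (nat \<Rightarrow> page set) \<Rightarrow> nat set" where
  "hits T \<sigma> C = {t \<in> {1..T}. \<sigma> t \<in> C (t - 1)}"

definition kept :: "nat \<Rightarrow> (nat \<Rightarrow> page) \<Rightarrow> (nat \<Rightarrow> page set) \<Rightarrow> nat set" where
  "kept T \<sigma> C =
     {u \<in> {1..T}. next_request T \<sigma> u \<le> T \<and> (\<forall>v\<in>{u..<next_request T \<sigma> u}. \<sigma> u \<in> C v)}"

definition mispredicted :: "nat \<Rightarrow> (nat \<Rightarrow> page) \<Rightarrow> (nat \<Rightarrow> nat) \<Rightarrow> nat set" where
  "mispredicted T \<sigma> q = {u \<in> {1..T}. q u \<noteq> next_request T \<sigma> u}"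

definition greedy_cache :: "nat \<Rightarrow> (nat \<Rightarrow> page) \<Rightarrow> (nat \<Rightarrow> nat) \<Rightarrow> nat \<Rightarrow> page set" where
  "greedy_cache k \<sigma> q t = \<sigma> ` {u \<in> greedy k q t. u = t \<or> t < q u}"

lemma next_request_arrives:
  assumes "u \<le> T" "1 \<le> \<sigma> u"
  shows "u < next_request T \<sigma> u"
    and "next_request T \<sigma> u \<le> T \<Longrightarrow> \<sigma> (next_request T \<sigma> u) = \<sigma> u"
proof -
  let ?P = "\<lambda>t'. u < t' \<and> (if t' \<le> T then \<sigma> t' else t' - T) = \<sigma> u"
  have "?P (T + \<sigma> u)"
    using assms by auto
  then have "?P (next_request T \<sigma> u)"
    unfolding next_request_def next_arrival_def by (rule LeastI)
  then show "u < next_request T \<sigma> u"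
    "next_request T \<sigma> u \<le> T \<Longrightarrow> \<sigma> (next_request T \<sigma> u) = \<sigma> u"
    by auto
qed

lemma next_request_le:
  assumes "u < v" "v \<le> T" "\<sigma> v = \<sigma> u"
  shows "next_request T \<sigma> u \<le> v"
  unfolding next_request_def next_arrival_def by (rule Least_le) (use assms in simp)

lemma inj_on_next_request:
  assumes "\<And>u. u \<in> {1..T} \<Longrightarrow> 1 \<le> \<sigma> u"
  shows "inj_on (next_request T \<sigma>) {u \<in> {1..T}. next_request T \<sigma> u \<le> T}"
proof (rule linorder_inj_onI', safe)
  fix u v
  assume uv: "u < v" "u \<in> {1..T}" "v \<in> {1..T}" "next_request T \<sigma> v \<le> T"
    and eq: "next_request T \<sigma> u = next_request T \<sigma> v"
  then have "\<sigma> u = \<sigma> v"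
    using next_request_arrives(2)[of u T \<sigma>] next_request_arrives(2)[of v T \<sigma>] assms by simp
  then have "next_request T \<sigma> u \<le> v"
    using uv by (intro next_request_le) auto
  moreover have "v < next_request T \<sigma> v"
    using uv assms by (intro next_request_arrives) auto
  ultimately show False
    using eq by simp
qed

lemma latest_request:
  assumes "u \<in> {1..<t}" "\<sigma> u = \<sigma> t" "t \<le> T"
  obtains v where "v \<in> {u..<t}" "\<sigma> v = \<sigma> t" "\<And>w. v < w \<Longrightarrow> w < t \<Longrightarrow> \<sigma> w \<noteq> \<sigma> t"
    "next_request T \<sigma> v = t"
proof -
  define V where "V = {v \<in> {u..<t}. \<sigma> v = \<sigma> t}"
  define v where "v = Max V"
  have fin: "finite V"
    by (simp add: V_def)
  have "v \<in> V"
    unfolding v_def by (rule Max_in[OF fin]) (use assms in \<open>auto simp: V_def\<close>)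
  then have v: "v \<in> {u..<t}" "\<sigma> v = \<sigma> t"
    by (auto simp: V_def)
  have last: "\<sigma> w \<noteq> \<sigma> t" if "v < w" "w < t" for w
  proof
    assume "\<sigma> w = \<sigma> t"
    then have "w \<in> V"
      using that v(1) by (simp add: V_def)
    then show False
      using Max_ge[OF fin] that(1) by (simp add: v_def leD)
  qed
  have "next_request T \<sigma> v = t"
    unfolding next_request_def next_arrival_def
  proof (rule Least_equality)
    fix w assume w: "v < w \<and> (if w \<le> T then \<sigma> w else w - T) = \<sigma> v"
    show "t \<le> w"
      by (rule ccontr) (use w last[of w] v assms(3) in auto)
  qed (use v assms(3) in auto)
  with v last show ?thesis
    using that by blast
qed

lemma card_mispredicted: "card (mispredicted T \<sigma> q) = pred_errors T \<sigma> q"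
  by (simp add: mispredicted_def pred_errors_def next_request_def)

lemma card_le_Diff_mispredicted: "card U \<le> card (U - mispredicted T \<sigma> q) + pred_errors T \<sigma> q"
  using diff_card_le_card_Diff[of "mispredicted T \<sigma> q" U]
  by (simp add: card_mispredicted) (simp add: mispredicted_def)

lemma card_serve:
  assumes "finite C" "e \<in> C"
  shows "finite (serve C x e)" "card (serve C x e) = card C"
  using assms card_Suc_Diff1[OF assms] by (simp_all add: serve_def)

lemma misses_eq: "misses T \<sigma> C = T - card (hits T \<sigma> C)"
proof -
  have "{t \<in> {1..T}. \<sigma> t \<notin> C (t - 1)} = {1..T} - hits T \<sigma> C" "hits T \<sigma> C \<subseteq> {1..T}"
    by (auto simp: hits_def)
  then show ?thesis
    by (simp add: misses_def card_Diff_subset finite_subset)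
qed

lemma card_hits_le: "card (hits T \<sigma> C) \<le> T"
  using card_mono[of "{1..T}" "hits T \<sigma> C"] by (force simp: hits_def)

context
  fixes T :: nat and C0 :: "page set" and \<sigma> :: "nat \<Rightarrow> page" and C :: "nat \<Rightarrow> page set"
  assumes feasible: "feasible_schedule T C0 \<sigma> C"
begin

lemma feasible_Suc:
  assumes "t < T"
  obtains e where "e \<in> C t" "C (Suc t) = serve (C t) (\<sigma> (Suc t)) e"
proof -
  have "\<exists>e\<in>C (Suc t - 1). C (Suc t) = serve (C (Suc t - 1)) (\<sigma> (Suc t)) e"
    by (rule bspec[of "{1..T}"]) (use feasible assms in \<open>auto simp: feasible_schedule_def\<close>)
  then show ?thesis
    using that by auto
qed

lemma feasible_card:
  assumes "finite C0" "t \<le> T"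
  shows "finite (C t) \<and> card (C t) = card C0"
  using assms(2)
proof (induction t)
  case 0
  then show ?case
    using assms feasible by (simp add: feasible_schedule_def)
next
  case (Suc t)
  then obtain e where e: "e \<in> C t" "C (Suc t) = serve (C t) (\<sigma> (Suc t)) e"
    using feasible_Suc[of t] by auto
  then show ?case
    using Suc card_serve[of "C t" e] by simp
qed

lemma requested_in_feasible:
  assumes "t \<in> {1..T}"
  shows "\<sigma> t \<in> C t"
proof -
  obtain s where s: "t = Suc s" "s < T"
    using assms by (cases t) auto
  then show ?thesis
    using feasible_Suc[of s] by (metis insertI1 serve_def)
qed

lemma in_feasible_backward:
  assumes "u \<le> v" "v \<le> T" "x \<in> C v" "\<And>w. u < w \<Longrightarrow> w \<le> v \<Longrightarrow> \<sigma> w \<noteq> x"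
  shows "x \<in> C u"
  using assms
proof (induction v rule: dec_induct)
  case (step v)
  then obtain e where "C (Suc v) = serve (C v) (\<sigma> (Suc v)) e"
    using feasible_Suc[of v] by (metis Suc_le_lessD)
  moreover have "\<sigma> (Suc v) \<noteq> x"
    using step by simp
  ultimately have "x \<in> C v"
    using step.prems by (auto simp: serve_def split: if_splits)
  then show ?case
    using step by simp
qed

lemma card_first_hits_le:
  assumes "finite C0"
  shows "card {t \<in> hits T \<sigma> C. \<forall>u\<in>{1..<t}. \<sigma> u \<noteq> \<sigma> t} \<le> card C0"
proof (rule card_inj_on_le)
  show "inj_on \<sigma> {t \<in> hits T \<sigma> C. \<forall>u\<in>{1..<t}. \<sigma> u \<noteq> \<sigma> t}"
    by (rule linorder_inj_onI') (auto simp: hits_def)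
  show "\<sigma> ` {t \<in> hits T \<sigma> C. \<forall>u\<in>{1..<t}. \<sigma> u \<noteq> \<sigma> t} \<subseteq> C0"
  proof clarify
    fix t assume t: "t \<in> hits T \<sigma> C" "\<forall>u\<in>{1..<t}. \<sigma> u \<noteq> \<sigma> t"
    have "\<sigma> t \<in> C 0"
      by (rule in_feasible_backward[of 0 "t - 1"]) (use t in \<open>auto simp: hits_def\<close>)
    then show "\<sigma> t \<in> C0"
      using feasible by (simp add: feasible_schedule_def)
  qed
qed (fact assms)

lemma repeated_hit_in_next_request_kept:
  assumes "t \<in> hits T \<sigma> C" "u \<in> {1..<t}" "\<sigma> u = \<sigma> t"
  shows "t \<in> next_request T \<sigma> ` kept T \<sigma> C"
proof -
  have t: "t \<le> T" "\<sigma> t \<in> C (t - 1)"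
    using assms(1) by (auto simp: hits_def)
  obtain v where v: "v \<in> {u..<t}" "\<sigma> v = \<sigma> t" "\<And>w. v < w \<Longrightarrow> w < t \<Longrightarrow> \<sigma> w \<noteq> \<sigma> t"
    "next_request T \<sigma> v = t"
    using latest_request[OF assms(2,3) t(1)] by metis
  have "\<sigma> t \<in> C w" if "w \<in> {v..<t}" for w
    by (rule in_feasible_backward[of w "t - 1"]) (use that t v(3) in auto)
  then have "v \<in> kept T \<sigma> C"
    using v(1,2,4) t(1) assms(2) by (auto simp: kept_def)
  then show ?thesis
    using v(4) by blast
qed

lemma card_hits_le_kept:
  assumes "finite C0"
  shows "card (hits T \<sigma> C) \<le> card C0 + card (kept T \<sigma> C)"
proof -
  let ?F = "{t \<in> hits T \<sigma> C. \<forall>u\<in>{1..<t}. \<sigma> u \<noteq> \<sigma> t}"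
  have fin: "finite (hits T \<sigma> C)" "finite (kept T \<sigma> C)"
    by (simp_all add: hits_def kept_def)
  have "hits T \<sigma> C \<subseteq> ?F \<union> next_request T \<sigma> ` kept T \<sigma> C"
    using repeated_hit_in_next_request_kept by auto
  then have "card (hits T \<sigma> C) \<le> card (?F \<union> next_request T \<sigma> ` kept T \<sigma> C)"
    using fin by (intro card_mono) simp_all
  also have "\<dots> \<le> card ?F + card (next_request T \<sigma> ` kept T \<sigma> C)"
    by (rule card_Un_le)
  also have "\<dots> \<le> card C0 + card (kept T \<sigma> C)"
    using card_first_hits_le[OF assms] fin by (intro add_mono card_image_le) simp_all
  finally show ?thesis .
qed

lemma card_running_kept:
  assumes "finite C0" "t \<in> {1..T}"
  shows "card (running (next_request T \<sigma>) (kept T \<sigma> C) t) < card C0"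
proof -
  let ?R = "running (next_request T \<sigma>) (kept T \<sigma> C) t"
  have C: "finite (C t)" "card (C t) = card C0" "\<sigma> t \<in> C t"
    using feasible_card[OF assms(1)] requested_in_feasible assms(2) by auto
  have no_repeat: "\<sigma> v \<noteq> \<sigma> u" if "u \<in> ?R" "u < v" "v \<le> t" for u v
    using that assms(2) next_request_le[of u v T \<sigma>] by (auto simp: running_def)
  have "card ?R \<le> card (C t - {\<sigma> t})"
  proof (rule card_inj_on_le)
    show "inj_on \<sigma> ?R"
    proof (rule linorder_inj_onI')
      fix u v assume "u \<in> ?R" "v \<in> ?R" "u < v"
      then show "\<sigma> u \<noteq> \<sigma> v"
        using no_repeat[of u v] by (auto simp: running_def)
    qed
    show "\<sigma> ` ?R \<subseteq> C t - {\<sigma> t}"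
      using no_repeat[of _ t] by (force simp: running_def kept_def)
  qed (simp add: C)
  also have "\<dots> < card C0"
    unfolding C(2)[symmetric] by (rule card_Diff1_less) (use C in auto)
  finally show ?thesis .
qed

end

lemma card_completed_greedy_le_hits:
  assumes "\<And>u. u \<in> {1..T} \<Longrightarrow> 1 \<le> \<sigma> u"
  shows "card (completed q (greedy k q T) T)
    \<le> card (hits T \<sigma> (greedy_cache k \<sigma> q)) + pred_errors T \<sigma> q"
proof -
  let ?Z = "completed q (greedy k q T) T - mispredicted T \<sigma> q"
  have Z: "u \<in> {1..T}" "u \<in> greedy k q T" "q u = next_request T \<sigma> u" "next_request T \<sigma> u \<le> T"
    if "u \<in> ?Z" for u
    using that greedy_subset[of k q T] by (auto simp: mispredicted_def completed_def)
  have "card ?Z \<le> card (hits T \<sigma> (greedy_cache k \<sigma> q))"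
  proof (rule card_inj_on_le)
    show "inj_on (next_request T \<sigma>) ?Z"
      by (rule inj_on_subset[OF inj_on_next_request]) (use assms Z in auto)
    show "next_request T \<sigma> ` ?Z \<subseteq> hits T \<sigma> (greedy_cache k \<sigma> q)"
    proof (rule image_subsetI)
      fix u assume u: "u \<in> ?Z"
      define t where "t = next_request T \<sigma> u"
      have t: "u < t" "t \<le> T" "\<sigma> t = \<sigma> u" "q u = t"
        using Z[OF u] next_request_arrives[of u T \<sigma>] assms by (auto simp: t_def)
      have "u \<in> greedy k q (t - 1)"
        by (rule greedy_antimono[OF Z(2)[OF u]]) (use t in auto)
      then have "\<sigma> t \<in> greedy_cache k \<sigma> q (t - 1)"
        using t by (force simp: greedy_cache_def)
      then show "next_request T \<sigma> u \<in> hits T \<sigma> (greedy_cache k \<sigma> q)"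
        using t by (simp add: hits_def flip: t_def)
    qed
  qed (simp add: hits_def)
  then show ?thesis
    using card_le_Diff_mispredicted[of "completed q (greedy k q T) T" T \<sigma> q] by linarith
qed

lemma greedy_cache_misses_le_feasible:
  assumes inst: "paging_instance n k T C0 \<sigma>" and feasible: "feasible_schedule T C0 \<sigma> C"
  shows "misses T \<sigma> (greedy_cache k \<sigma> q) \<le> misses T \<sigma> C + k + 2 * pred_errors T \<sigma> q"
proof -
  have C0: "finite C0" "card C0 = k" and \<sigma>: "\<And>u. u \<in> {1..T} \<Longrightarrow> 1 \<le> \<sigma> u"
    using inst by (auto simp: paging_instance_def finite_subset)
  define X where "X = kept T \<sigma> C - mispredicted T \<sigma> q"
  have X: "finite X" "0 \<notin> X" "completed q (X \<inter> {..T}) T = X"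
    by (auto simp: X_def mispredicted_def kept_def completed_def)
  have cap: "card (running q X t) < k" if "t \<in> {1..T}" for t
  proof -
    have "running q X t \<subseteq> running (next_request T \<sigma>) (kept T \<sigma> C) t"
      by (auto simp: running_def X_def mispredicted_def kept_def)
    then have "card (running q X t) \<le> card (running (next_request T \<sigma>) (kept T \<sigma> C) t)"
      by (intro card_mono finite_running) (simp add: kept_def)
    then show ?thesis
      using card_running_kept[OF feasible C0(1) that] C0(2) by simp
  qed
  have "card (hits T \<sigma> C) \<le> k + card (kept T \<sigma> C)"
    using card_hits_le_kept[OF feasible C0(1)] C0(2) by simp
  moreover have "card (kept T \<sigma> C) \<le> card X + pred_errors T \<sigma> q"
    unfolding X_def by (rule card_le_Diff_mispredicted)
  moreover have "card X \<le> card (completed q (greedy k q T) T)"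
    using greedy_stays_ahead[where T = T, OF X(1,2) cap order_refl order_refl] X(3) by simp
  moreover have "card (completed q (greedy k q T) T)
      \<le> card (hits T \<sigma> (greedy_cache k \<sigma> q)) + pred_errors T \<sigma> q"
    by (rule card_completed_greedy_le_hits[OF \<sigma>])
  moreover have "card (hits T \<sigma> C) \<le> T"
    by (rule card_hits_le)
  ultimately show ?thesis
    unfolding misses_eq by linarith
qed

lemma OPT_attained:
  assumes "C0 \<noteq> {}"
  obtains C where "feasible_schedule T C0 \<sigma> C" "misses T \<sigma> C = OPT T C0 \<sigma>"
proof -
  define C where "C = rec_nat C0 (\<lambda>t D. serve D (\<sigma> (Suc t)) (SOME e. e \<in> D))"
  have C_Suc: "C (Suc t) = serve (C t) (\<sigma> (Suc t)) (SOME e. e \<in> C t)" for t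
    by (simp add: C_def)
  have nonempty: "C t \<noteq> {}" for t
    by (induction t) (auto simp: C_Suc serve_def, simp add: C_def assms)
  have "feasible_schedule T C0 \<sigma> C"
    unfolding feasible_schedule_def
  proof (intro conjI ballI)
    fix t assume "t \<in> {1..T}"
    then obtain s where s: "t = Suc s"
      by (cases t) auto
    show "\<exists>e\<in>C (t - 1). C t = serve (C (t - 1)) (\<sigma> t) e"
      using C_Suc[of s] nonempty[of s] some_in_eq[of "C s"] unfolding s by auto
  qed (simp add: C_def)
  then have "OPT T C0 \<sigma> \<in> misses T \<sigma> ` {C. feasible_schedule T C0 \<sigma> C}"
    unfolding OPT_def by (intro Inf_nat_def1) auto
  then show ?thesis
    using that by auto
qed

theorem greedy_cache_misses_le_OPT:
  assumes "paging_instance n k T C0 \<sigma>"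
  shows "misses T \<sigma> (greedy_cache k \<sigma> q) \<le> OPT T C0 \<sigma> + k + 2 * pred_errors T \<sigma> q"
proof -
  have "C0 \<noteq> {}"
    using assms by (auto simp: paging_instance_def)
  then obtain C where "feasible_schedule T C0 \<sigma> C" "misses T \<sigma> C = OPT T C0 \<sigma>"
    by (rule OPT_attained)
  then show ?thesis
    using greedy_cache_misses_le_feasible[OF assms] by metis
qed

section \<open>Hedge\<close>

definition total_weight :: "'a set \<Rightarrow> ('a \<Rightarrow> real) \<Rightarrow> real" where
  "total_weight A x = (\<Sum>i\<in>A. exp (- x i))"

definition hedge_pmf :: "'a set \<Rightarrow> ('a \<Rightarrow> real) \<Rightarrow> 'a pmf" where
  "hedge_pmf A x = embed_pmf (\<lambda>i. if i \<in> A then exp (- x i) / total_weight A x else 0)"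

definition hedge_potential :: "'a set \<Rightarrow> real \<Rightarrow> ('a \<Rightarrow> real) \<Rightarrow> real" where
  "hedge_potential A e x = - ln (total_weight A (\<lambda>i. e * x i) / real (card A)) / e"

lemma total_weight_cong: "(\<And>i. i \<in> A \<Longrightarrow> x i = y i) \<Longrightarrow> total_weight A x = total_weight A y"
  by (simp add: total_weight_def)

lemma hedge_pmf_cong: "(\<And>i. i \<in> A \<Longrightarrow> x i = y i) \<Longrightarrow> hedge_pmf A x = hedge_pmf A y"
  unfolding hedge_pmf_def by (simp add: total_weight_cong[of A x y] cong: if_cong)

context
  fixes A :: "'a set"
  assumes A: "finite A" "A \<noteq> {}"
begin

lemma total_weight_pos: "0 < total_weight A x"
  unfolding total_weight_def using A by (intro sum_pos) auto

lemma pmf_hedge_pmf: "pmf (hedge_pmf A x) i = (if i \<in> A then exp (- x i) / total_weight A x else 0)"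
  unfolding hedge_pmf_def
proof (rule pmf_embed_pmf)
  let ?w = "\<lambda>i. exp (- x i) / total_weight A x"
  have "(\<integral>\<^sup>+ i. ennreal (if i \<in> A then ?w i else 0) \<partial>count_space UNIV)
      = (\<integral>\<^sup>+ i. ennreal (?w i) * indicator A i \<partial>count_space UNIV)"
    by (intro nn_integral_cong) (auto simp: indicator_def)
  also have "\<dots> = (\<Sum>i\<in>A. ennreal (?w i))"
    using A
    by (simp add: nn_integral_count_space_indicator[symmetric] nn_integral_count_space_finite)
  also have "\<dots> = ennreal (\<Sum>i\<in>A. ?w i)"
    using total_weight_pos[of x] by (intro sum_ennreal) simp
  also have "(\<Sum>i\<in>A. ?w i) = 1"
    using total_weight_pos[of x] by (simp add: total_weight_def flip: sum_divide_distrib)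
  finally show "(\<integral>\<^sup>+ i. ennreal (if i \<in> A then ?w i else 0) \<partial>count_space UNIV) = 1"
    by simp
qed (use total_weight_pos in \<open>simp add: less_imp_le\<close>)

lemma set_hedge_pmf: "set_pmf (hedge_pmf A x) = A"
  using total_weight_pos[of x] by (auto simp: set_pmf_eq pmf_hedge_pmf)

lemma expectation_hedge_pmf:
  fixes f :: "'a \<Rightarrow> real"
  shows "measure_pmf.expectation (hedge_pmf A x) f = (\<Sum>i\<in>A. exp (- x i) * f i) / total_weight A x"
  by (subst integral_measure_pmf_real[of A])
    (use A in \<open>auto simp: set_hedge_pmf pmf_hedge_pmf sum_divide_distrib mult.commute
        intro!: sum.cong\<close>)

lemma hedge_potential_zero: "hedge_potential A e (\<lambda>_. 0) = 0"
  using A by (simp add: hedge_potential_def total_weight_def)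

text \<open>The power mean inequality for the numbers \<open>exp (- x i)\<close> and the exponents \<open>a\<close> and \<open>b\<close>.\<close>

lemma hedge_potential_antimono:
  assumes "0 < a" "a \<le> b"
  shows "hedge_potential A b x \<le> hedge_potential A a x"
proof -
  define mean where "mean e = total_weight A (\<lambda>i. e * x i) / real (card A)" for e
  have pos: "0 < mean e" for e
    using A by (simp add: mean_def total_weight_pos card_gt_0_iff)
  have "convex_on {0<..} (\<lambda>z. z powr (b / a))"
    using assms by (intro powr_convex) simp
  then have "(\<Sum>i\<in>A. (1 / real (card A)) *\<^sub>R exp (- (a * x i))) powr (b / a)
      \<le> (\<Sum>i\<in>A. 1 / real (card A) * exp (- (a * x i)) powr (b / a))"
    by (rule convex_on_sum[OF A]) (use A in auto)
  then have "mean a powr (b / a) \<le> mean b"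
    using assms
    by (simp add: mean_def total_weight_def exp_powr_real mult.commute flip: sum_divide_distrib)
  then have "ln (mean a powr (b / a)) \<le> ln (mean b)"
    using pos by (subst ln_le_cancel_iff) (simp_all add: less_imp_neq[symmetric])
  then have "b * ln (mean a) \<le> a * ln (mean b)"
    using assms pos[of a] by (simp add: ln_powr field_simps)
  then show ?thesis
    using assms by (simp add: hedge_potential_def mean_def[symmetric] field_simps)
qed

lemma hedge_potential_step:
  assumes e: "0 < e" and bounds: "\<And>i. i \<in> A \<Longrightarrow> x i \<le> y i \<and> y i \<le> x i + 1"
  shows "measure_pmf.expectation (hedge_pmf A (\<lambda>i. e * x i)) (\<lambda>i. y i - x i)
    \<le> hedge_potential A e y - hedge_potential A e x + e / 8"
proof -
  let ?P = "hedge_pmf A (\<lambda>i. e * x i)" and ?W = "\<lambda>x. total_weight A (\<lambda>i. e * x i)"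
  define m where "m = measure_pmf.expectation ?P (\<lambda>i. y i - x i)"
  have W: "0 < ?W x" "0 < ?W y"
    by (rule total_weight_pos)+
  have "- (y i - x i) \<in> {- 1..0}" if "i \<in> A" for i
    using bounds[OF that] by simp
  then interpret interval_bounded_random_variable "measure_pmf ?P" "\<lambda>i. - (y i - x i)" "-1" 0
    by unfold_locales (simp_all add: AE_measure_pmf_iff set_hedge_pmf)
  have fin: "finite (set_pmf ?P)"
    using A by (simp add: set_hedge_pmf)
  have "exp (e * m) * (?W y / ?W x)
      = measure_pmf.expectation ?P (\<lambda>i. exp (e * (- (y i - x i) - - m)))"
    unfolding expectation_hedge_pmf
    by (simp add: total_weight_def sum_distrib_left algebra_simps flip: exp_add)
  also have "\<dots> \<le> exp (e\<^sup>2 / 8)"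
    using Hoeffdings_lemma_nn_integral[OF e]
    by (simp add: m_def nn_integral_eq_integral integrable_measure_pmf_finite[OF fin])
  finally have "ln (exp (e * m) * (?W y / ?W x)) \<le> ln (exp (e\<^sup>2 / 8))"
    using W by (subst ln_le_cancel_iff) simp_all
  also have "ln (exp (e * m) * (?W y / ?W x)) = e * m + (ln (?W y) - ln (?W x))"
    using W by (simp add: ln_mult ln_div)
  finally have "e * m \<le> ln (?W x) - ln (?W y) + e * (e / 8)"
    by (simp add: power2_eq_square)
  then have "m \<le> (ln (?W x) - ln (?W y)) / e + e / 8"
    using e by (simp add: field_simps)
  also have "(ln (?W x) - ln (?W y)) / e = hedge_potential A e y - hedge_potential A e x"
    using W A by (simp add: hedge_potential_def ln_div card_gt_0_iff diff_divide_distrib)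
  finally show ?thesis
    by (simp add: m_def)
qed

lemma hedge_potential_le:
  assumes "0 < e" "i \<in> A"
  shows "hedge_potential A e x \<le> x i + ln (real (card A)) / e"
proof -
  let ?W = "total_weight A (\<lambda>i. e * x i)"
  have "exp (- (e * x i)) \<le> ?W"
    unfolding total_weight_def
    using A assms by (intro member_le_sum[where f = "\<lambda>i. exp (- (e * x i))"]) auto
  then have "- (e * x i) \<le> ln ?W"
    using total_weight_pos by (simp add: ln_ge_iff)
  moreover have "ln (?W / real (card A)) = ln ?W - ln (real (card A))"
    using total_weight_pos[of "\<lambda>i. e * x i"] A by (simp add: ln_div card_gt_0_iff)
  ultimately show ?thesis
    using assms by (simp add: hedge_potential_def field_simps)
qed

end

section \<open>Hedge with few switches\<close>

lemma expectation_mono_finite: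
  fixes f g :: "'a \<Rightarrow> real"
  assumes "finite (set_pmf P)" "\<And>x. x \<in> set_pmf P \<Longrightarrow> f x \<le> g x"
  shows "measure_pmf.expectation P f \<le> measure_pmf.expectation P g"
  using assms
  by (intro integral_mono_AE) (auto simp: integrable_measure_pmf_finite AE_measure_pmf_iff)

lemma expectation_bind_finite:
  fixes h :: "'b \<Rightarrow> real"
  assumes "finite (set_pmf P)" "\<And>x. x \<in> set_pmf P \<Longrightarrow> finite (set_pmf (f x))"
  shows "measure_pmf.expectation (P \<bind> f) h =
    measure_pmf.expectation P (\<lambda>x. measure_pmf.expectation (f x) h)"
  using assms
  by (subst pmf_expectation_bind[of "set_pmf P"]) (auto simp: integral_measure_pmf[of "set_pmf P"])

definition lazy_step :: "('a \<Rightarrow> real) \<Rightarrow> 'a pmf \<Rightarrow> 'a \<Rightarrow> 'a pmf" where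
  "lazy_step \<kappa> P i = bernoulli_pmf (\<kappa> i) \<bind> (\<lambda>b. if b then return_pmf i else P)"

lemma set_lazy_step: "set_pmf (lazy_step \<kappa> P i) \<subseteq> insert i (set_pmf P)"
  by (auto simp: lazy_step_def split: if_splits)

lemma pmf_lazy_step:
  assumes "0 \<le> \<kappa> i" "\<kappa> i \<le> 1"
  shows "pmf (lazy_step \<kappa> P i) j = \<kappa> i * indicator {i} j + (1 - \<kappa> i) * pmf P j"
  using assms by (simp add: lazy_step_def pmf_bind indicator_def)

lemma prob_lazy_step_neq_le:
  assumes "0 \<le> \<kappa> i" "\<kappa> i \<le> 1"
  shows "measure_pmf.prob (lazy_step \<kappa> P i) {j. j \<noteq> i} \<le> 1 - \<kappa> i"
proof -
  have "measure_pmf.prob (lazy_step \<kappa> P i) {j. j \<noteq> i} = 1 - pmf (lazy_step \<kappa> P i) i"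
    using measure_pmf.prob_compl[of "{i}" "lazy_step \<kappa> P i"]
    by (simp add: measure_pmf_single Compl_eq_Diff_UNIV[symmetric] Compl_eq)
  then show ?thesis
    using assms by (simp add: pmf_lazy_step)
qed

lemma bind_lazy_step:
  assumes fin: "finite (set_pmf P)" and \<kappa>: "\<And>i. i \<in> set_pmf P \<Longrightarrow> 0 \<le> \<kappa> i \<and> \<kappa> i \<le> 1"
    and c: "\<And>i. pmf P i * \<kappa> i = c * pmf P' i" and sub: "set_pmf P' \<subseteq> set_pmf P"
  shows "P \<bind> lazy_step \<kappa> P' = P'"
proof (rule pmf_eqI)
  fix j
  let ?S = "set_pmf P"
  have "(\<Sum>i\<in>?S. pmf P i * \<kappa> i) = c * (\<Sum>i\<in>?S. pmf P' i)"
    by (simp add: c sum_distrib_left)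
  also have "(\<Sum>i\<in>?S. pmf P' i) = 1"
    by (rule sum_pmf_eq_1) (use fin sub in auto)
  finally have stay: "(\<Sum>i\<in>?S. pmf P i * \<kappa> i) = c"
    by simp
  have "pmf (P \<bind> lazy_step \<kappa> P') j = (\<Sum>i\<in>?S. pmf (lazy_step \<kappa> P' i) j * pmf P i)"
    unfolding pmf_bind by (rule integral_measure_pmf_real) (use fin in auto)
  also have "\<dots> = (\<Sum>i\<in>?S. (if i = j then pmf P j * \<kappa> j else 0)
      + pmf P' j * (pmf P i - pmf P i * \<kappa> i))"
    by (rule sum.cong) (use \<kappa> in \<open>auto simp: pmf_lazy_step algebra_simps\<close>)
  also have "\<dots> = (if j \<in> ?S then pmf P j * \<kappa> j else 0)
      + pmf P' j * ((\<Sum>i\<in>?S. pmf P i) - (\<Sum>i\<in>?S. pmf P i * \<kappa> i))"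
    using fin by (simp add: sum.distrib sum_distrib_left[symmetric] sum_subtractf)
  also have "(if j \<in> ?S then pmf P j * \<kappa> j else 0) = c * pmf P' j"
    using c[of j] by (auto simp: set_pmf_iff)
  also have "(\<Sum>i\<in>?S. pmf P i) = 1"
    using fin by (intro sum_pmf_eq_1) auto
  finally show "pmf (P \<bind> lazy_step \<kappa> P') j = pmf P' j"
    unfolding stay by (simp add: algebra_simps)
qed

definition hedge_dist :: "'a set \<Rightarrow> (nat \<Rightarrow> real) \<Rightarrow> (nat \<Rightarrow> 'a \<Rightarrow> real) \<Rightarrow> nat \<Rightarrow> 'a pmf" where
  "hedge_dist A e L t = hedge_pmf A (\<lambda>i. e t * L t i)"

text \<open>
  Up to normalisation, the ratio of the weights of \<open>i\<close> after rounds \<open>Suc t\<close> and \<open>t\<close>. The last term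
  in the exponent, which does not depend on \<open>i\<close>, keeps it below \<open>1\<close> although the learning rate
  decreases.
\<close>

definition stay_prob :: "(nat \<Rightarrow> real) \<Rightarrow> (nat \<Rightarrow> 'a \<Rightarrow> real) \<Rightarrow> nat \<Rightarrow> 'a \<Rightarrow> real" where
  "stay_prob e L t i =
     exp (e t * L t i - e (Suc t) * L (Suc t) i - (e t - e (Suc t)) * real (Suc t))"

definition next_action ::
  "'a set \<Rightarrow> (nat \<Rightarrow> real) \<Rightarrow> (nat \<Rightarrow> 'a \<Rightarrow> real) \<Rightarrow> 'a list \<Rightarrow> 'a pmf" where
  "next_action A e L xs = (case length xs of
     0 \<Rightarrow> hedge_dist A e L 0
   | Suc t \<Rightarrow> lazy_step (stay_prob e L t) (hedge_dist A e L (Suc t)) (last xs))"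

primrec action_history ::
  "'a set \<Rightarrow> (nat \<Rightarrow> real) \<Rightarrow> (nat \<Rightarrow> 'a \<Rightarrow> real) \<Rightarrow> nat \<Rightarrow> 'a list pmf" where
  "action_history A e L 0 = return_pmf []"
| "action_history A e L (Suc t) =
     action_history A e L t \<bind> (\<lambda>xs. map_pmf (\<lambda>i. xs @ [i]) (next_action A e L xs))"

definition incurred :: "(nat \<Rightarrow> 'a \<Rightarrow> real) \<Rightarrow> 'a list \<Rightarrow> real" where
  "incurred L xs = (\<Sum>t<length xs. L (Suc t) (xs ! t) - L t (xs ! t))"

definition switches :: "'a list \<Rightarrow> nat" where
  "switches xs = card {t. Suc t < length xs \<and> xs ! Suc t \<noteq> xs ! t}"

lemma incurred_Nil [simp]: "incurred L [] = 0"
  by (simp add: incurred_def)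

lemma incurred_snoc:
  "incurred L (xs @ [i]) = incurred L xs + (L (Suc (length xs)) i - L (length xs) i)"
  by (simp add: incurred_def nth_append)

lemma switches_Nil [simp]: "switches [] = 0"
  by (simp add: switches_def)

lemma switches_snoc: "switches (xs @ [i]) = switches xs + of_bool (xs \<noteq> [] \<and> i \<noteq> last xs)"
proof -
  let ?S = "{t. Suc t < length xs \<and> xs ! Suc t \<noteq> xs ! t}"
  have "{t. Suc t < length (xs @ [i]) \<and> (xs @ [i]) ! Suc t \<noteq> (xs @ [i]) ! t} =
      ?S \<union> (if xs \<noteq> [] \<and> i \<noteq> last xs then {length xs - 1} else {})"
    by (cases xs rule: rev_cases) (auto simp: nth_append less_Suc_eq)
  moreover have "finite ?S" "length xs - 1 \<notin> ?S"
    by (auto intro: finite_subset[of _ "{..<length xs}"])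
  ultimately show ?thesis
    by (simp add: switches_def)
qed

lemma next_action_cong:
  assumes "\<And>t i. t \<le> length xs \<Longrightarrow> i \<in> A \<Longrightarrow> L t i = L' t i" "set xs \<subseteq> A"
  shows "next_action A e L xs = next_action A e L' xs"
proof -
  have "hedge_dist A e L t = hedge_dist A e L' t" if "t \<le> length xs" for t
    unfolding hedge_dist_def by (rule hedge_pmf_cong) (simp add: assms(1)[OF that])
  moreover have "stay_prob e L t (last xs) = stay_prob e L' t (last xs)"
    if "length xs = Suc t" for t
  proof -
    have "last xs \<in> A"
      using assms(2) that by (cases xs rule: rev_cases) auto
    then show ?thesis
      using assms(1) that by (simp add: stay_prob_def)
  qed
  ultimately show ?thesis
    by (auto simp: next_action_def lazy_step_def split: nat.split)
qed

locale cumulative_losses =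
  fixes A :: "'a set" and L :: "nat \<Rightarrow> 'a \<Rightarrow> real"
  assumes finite_actions: "finite A" and actions_nonempty: "A \<noteq> {}"
    and no_initial_loss: "i \<in> A \<Longrightarrow> L 0 i = 0"
    and loss_mono: "i \<in> A \<Longrightarrow> L t i \<le> L (Suc t) i"
    and loss_Suc_le: "i \<in> A \<Longrightarrow> L (Suc t) i \<le> L t i + 1"
begin

lemma loss_bounds: "i \<in> A \<Longrightarrow> 0 \<le> L t i \<and> L t i \<le> real t"
proof (induction t)
  case (Suc t)
  then show ?case
    using loss_mono[of i t] loss_Suc_le[of i t] by simp
qed (simp add: no_initial_loss)

end

locale lazy_hedge = cumulative_losses A L
  for A :: "'a set" and L :: "nat \<Rightarrow> 'a \<Rightarrow> real" +
  fixes e :: "nat \<Rightarrow> real"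
  assumes rate_nonneg: "0 \<le> e t" and rate_antimono: "e (Suc t) \<le> e t"
begin

abbreviation law :: "nat \<Rightarrow> 'a pmf" where
  "law \<equiv> hedge_dist A e L"

abbreviation history :: "nat \<Rightarrow> 'a list pmf" where
  "history \<equiv> action_history A e L"

lemma set_law: "set_pmf (law t) = A"
  by (simp add: hedge_dist_def set_hedge_pmf finite_actions actions_nonempty)

lemma set_next_action:
  assumes "set xs \<subseteq> A"
  shows "set_pmf (next_action A e L xs) \<subseteq> A"
proof (cases xs rule: rev_cases)
  case (snoc ys i)
  then show ?thesis
    using assms set_lazy_step[of "stay_prob e L (length ys)" "law (Suc (length ys))" i]
    by (auto simp: next_action_def set_law)
qed (simp add: next_action_def set_law)

lemma set_history: "xs \<in> set_pmf (history t) \<Longrightarrow> length xs = t \<and> set xs \<subseteq> A"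
proof (induction t arbitrary: xs)
  case (Suc t)
  then obtain ys i where "xs = ys @ [i]" "ys \<in> set_pmf (history t)"
    "i \<in> set_pmf (next_action A e L ys)"
    by auto
  then show ?case
    using Suc.IH[of ys] set_next_action[of ys] by auto
qed simp

lemma finite_next_action: "xs \<in> set_pmf (history t) \<Longrightarrow> finite (set_pmf (next_action A e L xs))"
  by (rule finite_subset[OF set_next_action finite_actions]) (simp add: set_history)

lemma finite_history: "finite (set_pmf (history t))"
  by (induction t) (auto simp: finite_next_action)

lemma stay_prob_bounds:
  assumes "i \<in> A"
  shows "0 \<le> stay_prob e L t i" "stay_prob e L t i \<le> 1"
    "1 - stay_prob e L t i \<le> e (Suc t) + (e t - e (Suc t)) * real (Suc t)"
proof -
  define y where
    "y = e (Suc t) * (L (Suc t) i - L t i) + (e t - e (Suc t)) * (real (Suc t) - L t i)"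
  have stay: "stay_prob e L t i = exp (- y)"
    unfolding stay_prob_def y_def by (simp add: algebra_simps)
  note bounds = rate_nonneg[of "Suc t"] rate_antimono[of t] loss_bounds[OF assms, of t]
    loss_mono[OF assms, of t] loss_Suc_le[OF assms, of t]
  have "0 \<le> y"
    unfolding y_def using bounds by (intro add_nonneg_nonneg mult_nonneg_nonneg) auto
  then show "0 \<le> stay_prob e L t i" "stay_prob e L t i \<le> 1"
    by (simp_all add: stay)
  have "1 - exp (- y) \<le> y"
    using exp_ge_add_one_self[of "- y"] by simp
  also have "y \<le> e (Suc t) * 1 + (e t - e (Suc t)) * real (Suc t)"
    unfolding y_def using bounds by (intro add_mono mult_left_mono) auto
  finally show "1 - stay_prob e L t i \<le> e (Suc t) + (e t - e (Suc t)) * real (Suc t)"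
    by (simp add: stay)
qed

lemma law_Suc: "law t \<bind> lazy_step (stay_prob e L t) (law (Suc t)) = law (Suc t)"
proof -
  define W where "W t = total_weight A (\<lambda>i. e t * L t i)" for t
  define d where "d = (e t - e (Suc t)) * real (Suc t)"
  have W: "0 < W t" for t
    unfolding W_def by (rule total_weight_pos[OF finite_actions actions_nonempty])
  show ?thesis
  proof (rule bind_lazy_step[where c = "exp (- d) * W (Suc t) / W t"])
    show "pmf (law t) i * stay_prob e L t i
        = exp (- d) * W (Suc t) / W t * pmf (law (Suc t)) i" for i
      unfolding hedge_dist_def pmf_hedge_pmf[OF finite_actions actions_nonempty] W_def[symmetric]
        stay_prob_def d_def[symmetric]
      using W[of t] W[of "Suc t"] by (simp add: exp_diff exp_minus exp_add field_simps)
  qed (use stay_prob_bounds(1,2) finite_actions in \<open>auto simp: set_law\<close>)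
qed

lemma history_bind_next_action: "history t \<bind> next_action A e L = law t"
proof (induction t)
  case 0
  then show ?case
    by (simp add: bind_return_pmf next_action_def)
next
  case (Suc t)
  let ?step = "lazy_step (stay_prob e L t) (law (Suc t))"
  have "history (Suc t) \<bind> next_action A e L = history (Suc t) \<bind> (\<lambda>xs. ?step (last xs))"
  proof (rule bind_pmf_cong[OF refl])
    fix xs assume "xs \<in> set_pmf (history (Suc t))"
    then have "length xs = Suc t"
      by (simp only: set_history)
    then show "next_action A e L xs = ?step (last xs)"
      by (simp add: next_action_def)
  qed
  also have "\<dots> = (history t \<bind> next_action A e L) \<bind> ?step"
    by (simp add: bind_assoc_pmf bind_map_pmf)
  also have "\<dots> = law (Suc t)"
    unfolding Suc.IH by (rule law_Suc)
  finally show ?case .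
qed

lemma expectation_history_Suc:
  fixes h :: "'a list \<Rightarrow> real"
  shows "measure_pmf.expectation (history (Suc t)) h = measure_pmf.expectation (history t)
    (\<lambda>xs. measure_pmf.expectation (next_action A e L xs) (\<lambda>i. h (xs @ [i])))"
  by (simp add: expectation_bind_finite finite_history finite_next_action)

lemma expectation_incurred:
  "measure_pmf.expectation (history T) (incurred L)
    = (\<Sum>t<T. measure_pmf.expectation (law t) (\<lambda>i. L (Suc t) i - L t i))"
proof (induction T)
  case (Suc t)
  let ?l = "\<lambda>i. L (Suc t) i - L t i" and ?N = "next_action A e L"
  have "measure_pmf.expectation (?N xs) (\<lambda>i. incurred L (xs @ [i]))
      = incurred L xs + measure_pmf.expectation (?N xs) ?l" if "xs \<in> set_pmf (history t)" for xs
    using set_history[OF that]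
    by (simp add: incurred_snoc integrable_measure_pmf_finite finite_next_action[OF that]
        measure_pmf.prob_space)
  then have "measure_pmf.expectation (history (Suc t)) (incurred L)
      = measure_pmf.expectation (history t)
          (\<lambda>xs. incurred L xs + measure_pmf.expectation (?N xs) ?l)"
    unfolding expectation_history_Suc by (intro integral_cong_AE) (auto simp: AE_measure_pmf_iff)
  also have "\<dots> = measure_pmf.expectation (history t) (incurred L)
      + measure_pmf.expectation (history t \<bind> ?N) ?l"
    by (simp add: integrable_measure_pmf_finite finite_history expectation_bind_finite
        finite_next_action del: Bochner_Integration.integral_diff)
  finally show ?case
    by (simp add: Suc history_bind_next_action)
qed simp

lemma prob_switch_le:
  assumes "xs \<in> set_pmf (history (Suc t))"
  shows "measure_pmf.prob (next_action A e L xs) {i. i \<noteq> last xs}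
    \<le> e (Suc t) + (e t - e (Suc t)) * real (Suc t)"
proof -
  have "length xs = Suc t" "last xs \<in> A"
    using set_history[OF assms] by (cases xs rule: rev_cases; auto)+
  then show ?thesis
    using prob_lazy_step_neq_le[of "stay_prob e L t" "last xs" "law (Suc t)"]
      stay_prob_bounds[of "last xs" t] by (simp add: next_action_def)
qed

lemma expectation_switches_le_sum:
  "measure_pmf.expectation (history (Suc T)) (\<lambda>xs. real (switches xs))
    \<le> (\<Sum>t<T. e (Suc t) + (e t - e (Suc t)) * real (Suc t))"
proof (induction T)
  case 0
  show ?case
    by (subst expectation_history_Suc) (simp add: switches_snoc)
next
  case (Suc t)
  let ?b = "e (Suc t) + (e t - e (Suc t)) * real (Suc t)"
  have "measure_pmf.expectation (next_action A e L xs) (\<lambda>i. real (switches (xs @ [i])))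
      \<le> real (switches xs) + ?b" if "xs \<in> set_pmf (history (Suc t))" for xs
  proof -
    have "real (switches (xs @ [i])) = real (switches xs) + indicator {i. i \<noteq> last xs} i" for i
      using set_history[OF that] by (auto simp: switches_snoc)
    then show ?thesis
      using prob_switch_le[OF that]
      by (simp add: integrable_measure_pmf_finite finite_next_action[OF that]
          measure_pmf.prob_space)
  qed
  then have "measure_pmf.expectation (history (Suc (Suc t))) (\<lambda>xs. real (switches xs))
      \<le> measure_pmf.expectation (history (Suc t)) (\<lambda>xs. real (switches xs) + ?b)"
    by (subst expectation_history_Suc) (intro expectation_mono_finite finite_history)
  also have "\<dots> = measure_pmf.expectation (history (Suc t)) (\<lambda>xs. real (switches xs)) + ?b"
    by (simp add: integrable_measure_pmf_finite[OF finite_history] measure_pmf.prob_space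
        del: action_history.simps)
  finally show ?case
    using Suc by simp
qed

lemma expectation_switches_le:
  "measure_pmf.expectation (history T) (\<lambda>xs. real (switches xs)) \<le> 2 * (\<Sum>t<T. e t)"
proof (cases T)
  case (Suc t)
  have telescope: "(\<Sum>s<t. (e s - e (Suc s)) * real (Suc s)) = (\<Sum>s<t. e s) - real t * e t"
    by (induction t) (simp_all add: algebra_simps)
  have "(\<Sum>s<t. e (Suc s)) \<le> (\<Sum>s<t. e s)"
    by (intro sum_mono rate_antimono)
  then have "(\<Sum>s<t. e (Suc s) + (e s - e (Suc s)) * real (Suc s)) \<le> 2 * (\<Sum>s<t. e s)"
    using mult_nonneg_nonneg[OF of_nat_0_le_iff[of t] rate_nonneg[of t]]
    unfolding sum.distrib telescope by linarith
  then show ?thesis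
    using expectation_switches_le_sum[of t] rate_nonneg[of t]
    by (simp add: Suc del: action_history.simps)
qed simp

lemma hedge_regret:
  assumes pos: "\<And>t. 0 < e t" and i: "i \<in> A"
  shows "(\<Sum>t<T. measure_pmf.expectation (law t) (\<lambda>i. L (Suc t) i - L t i))
    \<le> L T i + ln (real (card A)) / e T + (\<Sum>t<T. e t) / 8"
proof -
  note A = finite_actions actions_nonempty
  have "(\<Sum>t<T. measure_pmf.expectation (law t) (\<lambda>i. L (Suc t) i - L t i))
      \<le> hedge_potential A (e T) (L T) + (\<Sum>t<T. e t) / 8"
  proof (induction T)
    case 0
    have "hedge_potential A (e 0) (L 0) = hedge_potential A (e 0) (\<lambda>_. 0)"
      using no_initial_loss by (simp add: hedge_potential_def cong: total_weight_cong)
    then show ?case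
      by (simp add: hedge_potential_zero A)
  next
    case (Suc T)
    have "measure_pmf.expectation (law T) (\<lambda>i. L (Suc T) i - L T i)
        \<le> hedge_potential A (e T) (L (Suc T)) - hedge_potential A (e T) (L T) + e T / 8"
      unfolding hedge_dist_def
      by (rule hedge_potential_step[OF A pos]) (use loss_mono loss_Suc_le in auto)
    moreover have "hedge_potential A (e T) (L (Suc T)) \<le> hedge_potential A (e (Suc T)) (L (Suc T))"
      by (rule hedge_potential_antimono[OF A pos rate_antimono])
    ultimately show ?case
      using Suc by (simp add: add_divide_distrib)
  qed
  also have "hedge_potential A (e T) (L T) \<le> L T i + ln (real (card A)) / e T"
    by (rule hedge_potential_le[OF A pos i])
  finally show ?thesis
    by simp
qed

end

definition learning_rate :: "nat \<Rightarrow> real \<Rightarrow> nat \<Rightarrow> real" where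
  "learning_rate N D t = sqrt (ln (real N) / (D * real (Suc t)))"

lemma sum_inverse_sqrt_le: "(\<Sum>t<T. 1 / sqrt (real (Suc t))) \<le> 2 * sqrt (real T)"
proof (induction T)
  case (Suc T)
  let ?a = "sqrt (real T)" and ?b = "sqrt (real (Suc T))"
  have "1 / ?b = (?b - ?a) * (?b + ?a) / ?b"
    by (simp add: algebra_simps)
  also have "\<dots> \<le> (?b - ?a) * (2 * ?b) / ?b"
    by (intro divide_right_mono mult_left_mono) auto
  also have "\<dots> = 2 * (?b - ?a)"
    by simp
  finally show ?case
    using Suc by simp
qed simp

lemma sum_learning_rate_le:
  assumes "0 < D" "1 \<le> N"
  shows "D * (\<Sum>t<T. learning_rate N D t) \<le> 2 * sqrt (real T * D * ln (real N))"
proof -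
  have "learning_rate N D t = sqrt (ln (real N) / D) * (1 / sqrt (real (Suc t)))" for t
    by (simp add: learning_rate_def real_sqrt_divide real_sqrt_mult)
  then have "D * (\<Sum>t<T. learning_rate N D t)
      = D * sqrt (ln (real N) / D) * (\<Sum>t<T. 1 / sqrt (real (Suc t)))"
    by (simp add: sum_distrib_left)
  also have "\<dots> \<le> D * sqrt (ln (real N) / D) * (2 * sqrt (real T))"
    using assms by (intro mult_left_mono sum_inverse_sqrt_le) auto
  also have "D * sqrt (ln (real N) / D) = sqrt D * sqrt (ln (real N))"
    using assms by (simp add: real_sqrt_divide) (simp add: field_simps)
  finally show ?thesis
    by (simp add: real_sqrt_mult algebra_simps)
qed

lemma ln_div_learning_rate_le:
  assumes "0 < D" "2 \<le> N" "1 \<le> T"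
  shows "ln (real N) / learning_rate N D T \<le> 2 * sqrt (real T * D * ln (real N))"
proof -
  have N: "0 < ln (real N)"
    using assms(2) by simp
  have "ln (real N) / learning_rate N D T = sqrt (real (Suc T) * D * ln (real N))"
    using N assms(1)
    by (simp add: learning_rate_def real_sqrt_divide real_sqrt_mult) (simp add: field_simps)
  also have "\<dots> \<le> sqrt (4 * (real T * D * ln (real N)))"
    unfolding mult.assoc[symmetric] using N assms
    by (intro real_sqrt_le_mono mult_right_mono) auto
  finally show ?thesis
    by (simp add: real_sqrt_mult)
qed

locale hedge_with_switching_cost = cumulative_losses A L
  for A :: "'a set" and L :: "nat \<Rightarrow> 'a \<Rightarrow> real" +
  fixes D :: real
  assumes switching_cost_ge_1: "1 \<le> D"
begin

lemma card_actions_ge_1: "1 \<le> card A"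
  using finite_actions actions_nonempty by (simp add: Suc_le_eq card_gt_0_iff)

sublocale lazy_hedge A L "learning_rate (card A) D"
proof
  fix t
  show "0 \<le> learning_rate (card A) D t"
    using card_actions_ge_1 switching_cost_ge_1 by (simp add: learning_rate_def)
  show "learning_rate (card A) D (Suc t) \<le> learning_rate (card A) D t"
    unfolding learning_rate_def using card_actions_ge_1 switching_cost_ge_1
    by (intro real_sqrt_le_mono divide_left_mono mult_left_mono) auto
qed

lemma expectation_incurred_singleton:
  assumes "A = {i}"
  shows "measure_pmf.expectation (history T) (incurred L) = L T i"
proof -
  have "measure_pmf.expectation (law t) (\<lambda>i. L (Suc t) i - L t i) = L (Suc t) i - L t i" for t
  proof -
    have "law t = return_pmf i"
      unfolding set_pmf_subset_singleton[symmetric] set_law by (simp add: assms)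
    then show ?thesis
      by simp
  qed
  then show ?thesis
    unfolding expectation_incurred
    using sum_lessThan_telescope[of "\<lambda>t. L t i" T] no_initial_loss[of i] by (simp add: assms)
qed

lemma expectation_incurred_le:
  assumes i: "i \<in> A"
  shows "measure_pmf.expectation (history T) (incurred L)
    \<le> L T i + 3 * sqrt (real T * D * ln (real (card A)))"
proof (cases "card A = 1 \<or> T = 0")
  case True
  moreover have ?thesis if "card A = 1"
  proof -
    have "A = {i}"
      using that i by (metis card_1_singletonE singletonD)
    then show ?thesis
      using expectation_incurred_singleton by (simp add: that)
  qed
  ultimately show ?thesis
    using no_initial_loss[OF i] by auto
next
  case False
  let ?N = "real (card A)" and ?e = "learning_rate (card A) D"
  have N: "2 \<le> card A" and T: "1 \<le> T" and D: "0 < D"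
    using False card_actions_ge_1 switching_cost_ge_1 by auto
  have pos: "0 < ?e t" for t
    using N D by (simp add: learning_rate_def)
  have "ln ?N / ?e T \<le> 2 * sqrt (real T * D * ln ?N)"
    by (rule ln_div_learning_rate_le[OF D N T])
  moreover have "(\<Sum>t<T. ?e t) \<le> D * (\<Sum>t<T. ?e t)"
    using mult_right_mono[OF switching_cost_ge_1, of "\<Sum>t<T. ?e t"] pos
    by (simp add: sum_nonneg less_imp_le)
  moreover have "D * (\<Sum>t<T. ?e t) \<le> 2 * sqrt (real T * D * ln ?N)"
    by (rule sum_learning_rate_le[OF D card_actions_ge_1])
  moreover have "0 \<le> sqrt (real T * D * ln ?N)"
    using N D by simp
  ultimately show ?thesis
    using hedge_regret[OF pos i, of T] unfolding expectation_incurred by linarith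
qed

theorem expectation_incurred_switches_le:
  assumes "i \<in> A"
  shows "measure_pmf.expectation (history T) (\<lambda>xs. incurred L xs + D * real (switches xs))
    \<le> L T i + 7 * sqrt (real T * D * ln (real (card A)))"
proof -
  have "measure_pmf.expectation (history T) (\<lambda>xs. incurred L xs + D * real (switches xs))
      = measure_pmf.expectation (history T) (incurred L)
        + D * measure_pmf.expectation (history T) (\<lambda>xs. real (switches xs))"
    by (simp add: integrable_measure_pmf_finite[OF finite_history])
  moreover have "D * measure_pmf.expectation (history T) (\<lambda>xs. real (switches xs))
      \<le> D * (2 * (\<Sum>t<T. learning_rate (card A) D t))"
    using switching_cost_ge_1 by (intro mult_left_mono expectation_switches_le) simp
  moreover have "D * (\<Sum>t<T. learning_rate (card A) D t)
      \<le> 2 * sqrt (real T * D * ln (real (card A)))"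
    using switching_cost_ge_1 card_actions_ge_1 by (intro sum_learning_rate_le) simp_all
  ultimately show ?thesis
    using expectation_incurred_le[OF assms, of T] by linarith
qed

end

section \<open>Lazily following cache schedules\<close>

definition demand_paging :: "nat \<Rightarrow> (nat \<Rightarrow> page) \<Rightarrow> (nat \<Rightarrow> page set) \<Rightarrow> bool" where
  "demand_paging k \<sigma> S \<longleftrightarrow> S 0 = {} \<and>
     (\<forall>t. card (S t) \<le> k \<and> \<sigma> (Suc t) \<in> S (Suc t) \<and> S (Suc t) \<subseteq> insert (\<sigma> (Suc t)) (S t))"

definition evict :: "page set \<Rightarrow> page set \<Rightarrow> page" where
  "evict C S = (SOME e. e \<in> (if C \<subseteq> S then C else C - S))"

definition follower ::
  "page set \<Rightarrow> (nat \<Rightarrow> page) \<Rightarrow> ('i \<Rightarrow> nat \<Rightarrow> page set) \<Rightarrow> 'i list \<Rightarrow> page set list" where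
  "follower C0 \<sigma> S =
     foldl (\<lambda>Cs i. Cs @ [serve (last Cs) (\<sigma> (length Cs)) (evict (last Cs) (S i (length Cs)))]) [C0]"

definition paging_loss :: "(nat \<Rightarrow> page) \<Rightarrow> ('i \<Rightarrow> nat \<Rightarrow> page set) \<Rightarrow> nat \<Rightarrow> 'i \<Rightarrow> real" where
  "paging_loss \<sigma> S t i = real (misses t \<sigma> (S i))"

lemma finite_demand_paging:
  assumes "demand_paging k \<sigma> S"
  shows "finite (S t)"
proof (induction t)
  case (Suc t)
  then show ?case
    using assms finite_subset[of "S (Suc t)" "insert (\<sigma> (Suc t)) (S t)"]
    by (simp add: demand_paging_def)
qed (use assms in \<open>simp add: demand_paging_def\<close>)

lemma evict_in: "C \<noteq> {} \<Longrightarrow> evict C S \<in> C"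
  using some_in_eq[of C] some_in_eq[of "C - S"] by (auto simp: evict_def)

lemma evict_notin: "\<not> C \<subseteq> S \<Longrightarrow> evict C S \<notin> S"
  using some_in_eq[of "C - S"] by (auto simp: evict_def)

lemma length_follower [simp]: "length (follower C0 \<sigma> S xs) = Suc (length xs)"
  by (induction xs rule: rev_induct) (simp_all add: follower_def)

lemma follower_Nil [simp]: "follower C0 \<sigma> S [] = [C0]"
  by (simp add: follower_def)

lemma follower_snoc:
  "follower C0 \<sigma> S (xs @ [i]) =
    (let Cs = follower C0 \<sigma> S xs; t = Suc (length xs)
     in Cs @ [serve (last Cs) (\<sigma> t) (evict (last Cs) (S i t))])"
  using length_follower[of C0 \<sigma> S xs] by (simp add: follower_def Let_def)

lemma last_follower:
  assumes "finite C0" "C0 \<noteq> {}"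
  shows "finite (last (follower C0 \<sigma> S xs)) \<and> card (last (follower C0 \<sigma> S xs)) = card C0"
proof (induction xs rule: rev_induct)
  case (snoc i xs)
  let ?C = "last (follower C0 \<sigma> S xs)"
  have "?C \<noteq> {}"
    using snoc assms by (metis card_0_eq)
  then show ?case
    using snoc card_serve[of ?C "evict ?C (S i (Suc (length xs)))"]
    by (simp add: follower_snoc Let_def evict_in)
qed (simp add: assms)

lemma misses_Suc: "misses (Suc t) \<sigma> C = misses t \<sigma> C + of_bool (\<sigma> (Suc t) \<notin> C t)"
proof -
  let ?B = "{s \<in> {1..t}. \<sigma> s \<notin> C (s - 1)}"
  have "{s \<in> {1..Suc t}. \<sigma> s \<notin> C (s - 1)} = (if \<sigma> (Suc t) \<notin> C t then insert (Suc t) ?B else ?B)"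
    by (auto simp: le_Suc_eq)
  moreover have "finite ?B" "Suc t \<notin> ?B"
    by auto
  ultimately show ?thesis
    by (simp add: misses_def)
qed

lemma misses_cong:
  assumes "\<And>s. s \<in> {1..t} \<Longrightarrow> \<sigma> s = \<sigma>' s" "\<And>s. s < t \<Longrightarrow> C s = C' s"
  shows "misses t \<sigma> C = misses t \<sigma>' C'"
  using assms by (induction t) (simp_all add: misses_Suc, simp add: misses_def)

lemma paging_loss_0 [simp]: "paging_loss \<sigma> S 0 i = 0"
  by (simp add: paging_loss_def misses_def)

lemma paging_loss_Suc:
  "paging_loss \<sigma> S (Suc t) i = paging_loss \<sigma> S t i + of_bool (\<sigma> (Suc t) \<notin> S i t)"
  by (simp add: paging_loss_def misses_Suc)

text \<open>
  \<open>card (S - C)\<close> pays for the misses of the follower on pages that the followed cache \<open>S\<close> has.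
\<close>

lemma lazy_eviction_potential:
  fixes C S S' :: "page set"
  assumes C: "finite C" and S: "finite S" "card S' \<le> card C"
    and sub: "S' \<subseteq> insert x S" "x \<in> S'"
  shows "of_bool (x \<notin> C) + card (S' - serve C x (evict C S')) \<le> of_bool (x \<notin> S) + card (S - C)"
proof (cases "x \<in> C")
  case True
  then have "card (S' - C) \<le> card (S - C)"
    using S sub by (intro card_mono) auto
  then show ?thesis
    using True by (simp add: serve_def)
next
  case False
  have "finite S'"
    using S(1) sub(1) by (simp add: finite_subset)
  have "\<not> C \<subseteq> S'"
  proof
    assume "C \<subseteq> S'"
    then have "card C < card S'"
      using False sub(2) \<open>finite S'\<close> by (intro psubset_card_mono) auto
    then show False
      using S by simp
  qed
  then have "S' - serve C x (evict C S') \<subseteq> S - C - {x}"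
    using evict_notin False sub by (auto simp: serve_def)
  then have "card (S' - serve C x (evict C S')) \<le> card (S - C - {x})"
    using S by (intro card_mono) auto
  moreover have "card (S - C - {x}) + of_bool (x \<in> S) = card (S - C)"
    using False S card_Suc_Diff1[of "S - C" x] by (cases "x \<in> S") auto
  ultimately show ?thesis
    using False by (cases "x \<in> S") auto
qed

lemma card_Diff_switch_le:
  assumes S: "\<And>i. demand_paging k \<sigma> (S i)"
  shows "card (S j t - C) \<le> card (S i t - C) + k * of_bool (t \<noteq> 0 \<and> j \<noteq> i)"
proof (cases "t = 0 \<or> j = i")
  case True
  then show ?thesis
    using S by (auto simp: demand_paging_def)
next
  case False
  have "card (S j t - C) \<le> card (S j t)"
    using finite_demand_paging[OF S] by (intro card_mono) auto
  also have "\<dots> \<le> k"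
    using S[of j] by (simp add: demand_paging_def)
  finally show ?thesis
    using False by simp
qed

lemma misses_follower_snoc:
  "misses (Suc (length xs)) \<sigma> ((!) (follower C0 \<sigma> S (xs @ [i])))
    = misses (length xs) \<sigma> ((!) (follower C0 \<sigma> S xs))
      + of_bool (\<sigma> (Suc (length xs)) \<notin> last (follower C0 \<sigma> S xs))"
proof -
  let ?Cs = "follower C0 \<sigma> S xs"
  have "?Cs ! length xs = last ?Cs"
    by (metis diff_Suc_1 last_conv_nth length_follower list.size(3) nat.distinct(1))
  moreover have "misses (length xs) \<sigma> ((!) (follower C0 \<sigma> S (xs @ [i])))
      = misses (length xs) \<sigma> ((!) ?Cs)"
    by (rule misses_cong) (simp_all add: follower_snoc Let_def nth_append)
  ultimately show ?thesis
    by (simp add: misses_Suc follower_snoc Let_def nth_append)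
qed

text \<open>\<open>last []\<close> is harmless because every \<open>S i\<close> starts empty.\<close>

lemma misses_follower_potential:
  assumes S: "\<And>i. demand_paging k \<sigma> (S i)" and C0: "finite C0" "C0 \<noteq> {}" "card C0 = k"
  shows "real (misses (length xs) \<sigma> ((!) (follower C0 \<sigma> S xs))
      + card (S (last xs) (length xs) - last (follower C0 \<sigma> S xs)))
    \<le> incurred (paging_loss \<sigma> S) xs + real k * real (switches xs)"
proof (induction xs rule: rev_induct)
  case Nil
  then show ?case
    using S by (simp add: misses_def demand_paging_def)
next
  case (snoc i xs)
  let ?t = "length xs"
  let ?C = "last (follower C0 \<sigma> S xs)" and ?C' = "last (follower C0 \<sigma> S (xs @ [i]))"
  have C: "finite ?C" "card ?C = k"
    using last_follower[OF C0(1,2)] C0(3) by auto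
  have "of_bool (\<sigma> (Suc ?t) \<notin> ?C) + card (S i (Suc ?t) - ?C')
      \<le> of_bool (\<sigma> (Suc ?t) \<notin> S i ?t) + card (S i ?t - ?C)"
    using lazy_eviction_potential[OF C(1) finite_demand_paging[OF S]] S[of i] C(2)
    by (simp add: follower_snoc Let_def demand_paging_def)
  moreover have "card (S i ?t - ?C)
      \<le> card (S (last xs) ?t - ?C) + k * of_bool (?t \<noteq> 0 \<and> i \<noteq> last xs)"
    by (rule card_Diff_switch_le[OF S])
  ultimately have "misses (Suc ?t) \<sigma> ((!) (follower C0 \<sigma> S (xs @ [i]))) + card (S i (Suc ?t) - ?C')
      \<le> misses ?t \<sigma> ((!) (follower C0 \<sigma> S xs)) + card (S (last xs) ?t - ?C)
        + of_bool (\<sigma> (Suc ?t) \<notin> S i ?t) + k * of_bool (?t \<noteq> 0 \<and> i \<noteq> last xs)"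
    unfolding misses_follower_snoc by linarith
  then have "real (misses (Suc ?t) \<sigma> ((!) (follower C0 \<sigma> S (xs @ [i]))) + card (S i (Suc ?t) - ?C'))
      \<le> real (misses ?t \<sigma> ((!) (follower C0 \<sigma> S xs)) + card (S (last xs) ?t - ?C)
        + of_bool (\<sigma> (Suc ?t) \<notin> S i ?t) + k * of_bool (?t \<noteq> 0 \<and> i \<noteq> last xs))"
    by (rule of_nat_mono)
  also have "\<dots> \<le> incurred (paging_loss \<sigma> S) (xs @ [i]) + real k * real (switches (xs @ [i]))"
    using snoc by (simp add: incurred_snoc switches_snoc paging_loss_Suc distrib_left)
  finally show ?case
    by simp
qed

lemma misses_follower_le:
  assumes "\<And>i. demand_paging k \<sigma> (S i)" "finite C0" "C0 \<noteq> {}" "card C0 = k"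
  shows "real (misses (length xs) \<sigma> ((!) (follower C0 \<sigma> S xs)))
    \<le> incurred (paging_loss \<sigma> S) xs + real k * real (switches xs)"
  using misses_follower_potential[where S = S, OF assms, of xs] by simp

section \<open>Following the greedy caches of the predictors\<close>

lemma demand_paging_greedy_cache:
  assumes "1 \<le> k"
  shows "demand_paging k \<sigma> (greedy_cache k \<sigma> q)"
  unfolding demand_paging_def
proof (intro conjI allI)
  show "greedy_cache k \<sigma> q 0 = {}"
    by (simp add: greedy_cache_def)
next
  fix t
  let ?H = "{u \<in> greedy k q t. u = t \<or> t < q u}"
  have "?H \<subseteq> insert t (running q (greedy k q t) t)"
    using greedy_subset[of k q t] by (fastforce simp: running_def)
  then have "card ?H \<le> card (insert t (running q (greedy k q t) t))"
    by (intro card_mono) (simp_all add: finite_running finite_greedy)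
  also have "\<dots> \<le> k"
    using card_running_greedy[OF assms, of q t]
    by (simp add: card_insert_if finite_running finite_greedy)
  finally show "card (greedy_cache k \<sigma> q t) \<le> k"
    using card_image_le[of ?H \<sigma>] by (simp add: greedy_cache_def finite_greedy)
next
  fix t
  show "\<sigma> (Suc t) \<in> greedy_cache k \<sigma> q (Suc t)"
    by (simp add: greedy_cache_def)
  show "greedy_cache k \<sigma> q (Suc t) \<subseteq> insert (\<sigma> (Suc t)) (greedy_cache k \<sigma> q t)"
    using greedy_Suc_subset[of k q t] by (force simp: greedy_cache_def)
qed

lemma greedy_cache_cong:
  assumes "\<And>u. u \<in> {1..t} \<Longrightarrow> \<sigma> u = \<sigma>' u" "\<And>u. u \<in> {1..<t} \<Longrightarrow> q u = q' u"
  shows "greedy_cache k \<sigma> q t = greedy_cache k \<sigma>' q' t"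
proof -
  have "greedy k q t = greedy k q' t"
    by (rule greedy_cong) (rule assms(2))
  moreover have "u = t \<or> t < q u \<longleftrightarrow> u = t \<or> t < q' u" if "u \<in> greedy k q' t" for u
    using that assms(2)[of u] greedy_subset[of k q' t] by (cases "u = t") auto
  ultimately have "{u \<in> greedy k q t. u = t \<or> t < q u} = {u \<in> greedy k q' t. u = t \<or> t < q' u}"
    by blast
  then show ?thesis
    unfolding greedy_cache_def
    by (intro image_cong) (use assms(1) greedy_subset[of k q' t] in auto)
qed

definition follow_alg :: rand_alg where
  "follow_alg v =
     (let \<sigma> = \<lambda>u. requests v ! (u - 1);
          p = \<lambda>j u. predictions v ! (u - 1) ! (j - 1);
          S = \<lambda>j. greedy_cache (cache_size v) \<sigma> (p j);
          A = {1..num_predictors v}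
      in map_pmf (\<lambda>j. (evict (last (caches v)) (S j (length (requests v))), j))
           (next_action A (learning_rate (card A) (real (cache_size v)))
             (paging_loss \<sigma> S) (draws v)))"

lemma rand_paging_alg_follow_alg: "rand_paging_alg follow_alg"
  by (auto simp: rand_paging_alg_def follow_alg_def Let_def evict_in)

locale predictors =
  fixes n k M :: nat and C0 :: "page set" and \<sigma> :: "nat \<Rightarrow> page" and p :: "nat \<Rightarrow> nat \<Rightarrow> nat"
  assumes k: "1 \<le> k" and M: "1 \<le> M" and C0: "finite C0" "card C0 = k"
begin

abbreviation S :: "nat \<Rightarrow> nat \<Rightarrow> page set" where
  "S \<equiv> \<lambda>j. greedy_cache k \<sigma> (p j)"

abbreviation L :: "nat \<Rightarrow> nat \<Rightarrow> real" where
  "L \<equiv> paging_loss \<sigma> S"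

abbreviation draw_expert :: "(nat \<Rightarrow> nat \<Rightarrow> real) \<Rightarrow> nat list \<Rightarrow> nat pmf" where
  "draw_expert \<equiv> next_action {1..M} (learning_rate (card {1..M}) (real k))"

sublocale hedge_with_switching_cost "{1..M}" L "real k"
  by unfold_locales (use k M in \<open>auto simp: paging_loss_Suc\<close>)

lemma follow_alg_view_at:
  assumes draws: "length rs = t" "set rs \<subseteq> {1..M}"
  shows "follow_alg (view_at n k M \<sigma> p (Suc t) Cs rs) =
    map_pmf (\<lambda>j. (evict (last Cs) (S j (Suc t)), j)) (draw_expert L rs)"
proof -
  let ?v = "view_at n k M \<sigma> p (Suc t) Cs rs"
  define \<sigma>' where "\<sigma>' = (\<lambda>u. requests ?v ! (u - 1))"
  define p' where "p' = (\<lambda>j u. predictions ?v ! (u - 1) ! (j - 1))"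
  define S' where "S' = (\<lambda>j. greedy_cache k \<sigma>' (p' j))"
  have \<sigma>': "\<sigma>' u = \<sigma> u" if "u \<in> {1..Suc t}" for u
    using that by (cases u) (simp_all add: \<sigma>'_def view_at_def nth_map_upt del: upt_Suc)
  have p': "p' j u = p j u" if "j \<in> {1..M}" "u \<in> {1..<Suc t}" for j u
    using that by (cases j; cases u) (simp_all add: p'_def view_at_def nth_map_upt del: upt_Suc)
  have S': "S' j s = S j s" if "j \<in> {1..M}" "s \<le> Suc t" for j s
    unfolding S'_def by (rule greedy_cache_cong) (use that \<sigma>' p' in auto)
  have "draw_expert (paging_loss \<sigma>' S') rs = draw_expert L rs"
  proof (rule next_action_cong[OF _ draws(2)])
    fix s j assume "s \<le> length rs" "j \<in> {1..M}"
    then show "paging_loss \<sigma>' S' s j = L s j"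
      unfolding paging_loss_def
      by (intro arg_cong[where f = real] misses_cong) (use \<sigma>' S' draws in auto)
  qed
  moreover have "follow_alg ?v =
      map_pmf (\<lambda>j. (evict (last Cs) (S' j (Suc t)), j)) (draw_expert (paging_loss \<sigma>' S') rs)"
    unfolding \<sigma>'_def p'_def S'_def by (simp add: follow_alg_def Let_def view_at_def del: upt_Suc)
  ultimately show ?thesis
    using set_next_action[OF draws(2)] S' by (auto intro!: map_pmf_cong)
qed

lemma run_follow_alg:
  "run follow_alg n k M C0 \<sigma> p t = map_pmf (\<lambda>rs. (follower C0 \<sigma> S rs, rs)) (history t)"
proof (induction t)
  case (Suc t)
  show ?case
    unfolding run.simps Suc.IH action_history.simps bind_map_pmf map_bind_pmf
  proof (rule bind_pmf_cong[OF refl])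
    fix rs assume "rs \<in> set_pmf (history t)"
    then have "length rs = t" "set rs \<subseteq> {1..M}"
      using set_history by auto
    then show "(case (follower C0 \<sigma> S rs, rs) of (Cs, rs) \<Rightarrow>
        follow_alg (view_at n k M \<sigma> p (Suc t) Cs rs) \<bind>
          (\<lambda>(e, r). return_pmf (Cs @ [serve (last Cs) (\<sigma> (Suc t)) e], rs @ [r]))) =
      map_pmf (\<lambda>rs. (follower C0 \<sigma> S rs, rs)) (map_pmf (\<lambda>j. rs @ [j]) (draw_expert L rs))"
      by (simp add: follow_alg_view_at follower_snoc Let_def map_pmf_def bind_assoc_pmf
          bind_return_pmf)
  qed
qed simp

theorem expected_cost_follow_alg_le:
  assumes "j \<in> {1..M}"
  shows "expected_cost follow_alg n k M T C0 \<sigma> p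
    \<le> real (misses T \<sigma> (S j)) + 7 * sqrt (real T * real k * ln (real M))"
proof -
  have "C0 \<noteq> {}"
    using C0 k by auto
  have "expected_cost follow_alg n k M T C0 \<sigma> p =
      measure_pmf.expectation (history T) (\<lambda>rs. real (misses T \<sigma> ((!) (follower C0 \<sigma> S rs))))"
    by (simp add: expected_cost_def run_follow_alg)
  also have "\<dots> \<le> measure_pmf.expectation (history T)
      (\<lambda>rs. incurred L rs + real k * real (switches rs))"
  proof (rule expectation_mono_finite[OF finite_history])
    fix rs assume "rs \<in> set_pmf (history T)"
    then have "length rs = T"
      using set_history by blast
    then show "real (misses T \<sigma> ((!) (follower C0 \<sigma> S rs)))
        \<le> incurred L rs + real k * real (switches rs)"
      using misses_follower_le[OF demand_paging_greedy_cache[OF k] C0(1) \<open>C0 \<noteq> {}\<close> C0(2)]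
      by blast
  qed
  also have "\<dots> \<le> L T j + 7 * sqrt (real T * real k * ln (real M))"
    using expectation_incurred_switches_le[OF assms, of T] by simp
  finally show ?thesis
    by (simp add: paging_loss_def)
qed

end

theorem theorem3:
  shows "\<exists>(A :: rand_alg) (c :: real). rand_paging_alg A \<and> c > 0 \<and>
    (\<forall>n k T M C0 \<sigma> p.
       paging_instance n k T C0 \<sigma> \<and> M \<ge> 1 \<and> nat_predictors n T M p \<longrightarrow>
       expected_cost A n k M T C0 \<sigma> p - real (OPT T C0 \<sigma>)
         \<le> c * (real (min_pred_errors T \<sigma> M p) + real k + sqrt (real T * real k * ln (real M))))"
proof (rule exI[of _ follow_alg], rule exI[of _ 7], intro conjI allI impI)
  show "rand_paging_alg follow_alg"
    by (rule rand_paging_alg_follow_alg)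
  show "(7 :: real) > 0"
    by simp
  fix n k T M :: nat and C0 :: "page set" and \<sigma> :: "nat \<Rightarrow> page" and p :: "nat \<Rightarrow> nat \<Rightarrow> nat"
  assume "paging_instance n k T C0 \<sigma> \<and> M \<ge> 1 \<and> nat_predictors n T M p"
  then have inst: "paging_instance n k T C0 \<sigma>" and M: "M \<ge> 1"
    by auto
  then interpret predictors n k M C0 \<sigma> p
    by unfold_locales (auto simp: paging_instance_def finite_subset)
  have "min_pred_errors T \<sigma> M p \<in> (\<lambda>j. pred_errors T \<sigma> (p j)) ` {1..M}"
    unfolding min_pred_errors_def using M by (intro Min_in) auto
  then obtain j where j: "j \<in> {1..M}" "min_pred_errors T \<sigma> M p = pred_errors T \<sigma> (p j)"
    by auto
  show "expected_cost follow_alg n k M T C0 \<sigma> p - real (OPT T C0 \<sigma>)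
      \<le> 7 * (real (min_pred_errors T \<sigma> M p) + real k + sqrt (real T * real k * ln (real M)))"
    using expected_cost_follow_alg_le[OF j(1), of T]
      greedy_cache_misses_le_OPT[OF inst, of "p j"] j(2) by simp
qed

end
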